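(* Let $f:\Omega\to\mathbb{R}$ be a Lipschitz function with Lipschitz coefficient $\|f\|_{\mathrm{Lip}}$. Suppose that $\sigma^2(x)/n(x)\le S(x)$ for every $x\in\Omega$, for some Lipschitz function $S:\Omega\to\mathbb{R}$ with Lipschitz coefficient $\|S\|_{\mathrm{Lip}}$. Let $K$ be a positive integer such that $\kappa_K>0$. Let $$D:=\|f\|_{\mathrm{Lip}}^2\,\mathbb{E}_{\pi}(S)\cdot\frac{16M^2K}{\kappa_K-\kappa_K^2/4},$$ $$\lambda_{\max}':=\min\left(\frac{1}{6M\sigma_\infty\|f\|_{\mathrm{Lip}}},\ \frac{\kappa_K}{4KM^2\|S\|_{\mathrm{Lip}}\|f\|_{\mathrm{Lip}}}\right),\qquad t_{\max}':=D\lambda_{\max}'/2 .$$ Let $X\sim\pi$. Then for $0\le t\le t_{\max}'$, $$\mathbb{P}_{\pi}(|f(X)-\mathbb{E}_{\pi}(f)|\ge t)\le 2\exp\left(-\frac{t^2}{D}\right),$$ while for $t>t_{\max}'$, $$\mathbb{P}_{\pi}(|f(X)-\mathbb{E}_{\pi}(f)|\ge t)\le 2\exp\left(-\frac{(t_{\max}')^2}{D}-(t-t_{\max}')\cdot\lambda_{\max}'\right).$$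
   Context: $(\Omega,d)$ is a Polish metric space and $P(x,\mathrm{d}y)$ is a Markov kernel on $\Omega$, measurable in $x$, with stationary distribution $\pi$; $P_x=P(x,\cdot)$, and $W_1(\delta_x,P_x)<\infty$ for every $x$. $P^k_x$ is the $k$-step kernel, $P^0_x=\delta_x$. $W_1(\mu_1,\mu_2)=\inf\mathbb{E}(d(X,Y))$ over all couplings $(X,Y)$ of $\mu_1,\mu_2$. No reversibility is assumed. Multi-step coarse Ricci curvature: $\kappa_k(x,y)=1-W_1(P^k_x,P^k_y)/d(x,y)$ for $x\ne y$, $\kappa_k(x,x)=1$, $\kappa_k=\inf_{x,y\in\Omega}\kappa_k(x,y)$; $M=\sup_{k\ge0}(1-\kappa_k)$. Coarse diffusion constant at $x$: $\sigma(x)=\left(\frac12\iint d(y,z)^2\,\mathrm{d}P_x(y)\,\mathrm{d}P_x(z)\right)^{1/2}$. Local dimension at $x$: $n(x)=\sigma(x)^2/\sup\{\mathrm{Var}_{P_x}f : f:\mathrm{Supp}\,P_x\to\mathbb{R}\ 1\text{-Lipschitz}\}$; thus $\sigma^2(x)/n(x)=\sup\{\mathrm{Var}_{P_x}f: f\ 1\text{-Lipschitz on }\mathrm{Supp}\,P_x\}$, which is also the reading when $\sigma(x)=0$. Granularity: $\sigma_\infty=\sup_{x\in\Omega}\frac12\,\mathrm{diam}\,\mathrm{Supp}\,P_x$. It is understood that $0<\sigma_\infty<\infty$, $M<\infty$, $\|f\|_{\mathrm{Lip}}>0$ and $0<\mathbb{E}_\pi(S)<\infty$, so that the expressions are meaningful;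 if $\|S\|_{\mathrm{Lip}}=0$ the second term in the minimum is $+\infty$. *)

theory Defs
  imports "HOL-Probability.Probability"
begin

text \<open>Extended-valued quantities are kept in \<^typ>\<open>ennreal\<close> or \<^typ>\<open>ereal\<close>, so that
  infinite values stay infinite and nothing depends on conventions for divergent integrals
  or unbounded suprema.\<close>

definition couplings ::
    "'a::polish_space measure \<Rightarrow> 'a measure \<Rightarrow> ('a \<times> 'a) measure set" where
  "couplings \<mu> \<nu> = {\<gamma> \<in> space (prob_algebra (borel \<Otimes>\<^sub>M borel)).
     distr \<gamma> borel fst = \<mu> \<and> distr \<gamma> borel snd = \<nu>}"

definition W1 :: "'a::polish_space measure \<Rightarrow> 'a measure \<Rightarrow> ennreal" where
  "W1 \<mu> \<nu> = (INF \<gamma>\<in>couplings \<mu> \<nu>. \<integral>\<^sup>+ p. ennreal (dist (fst p) (snd p)) \<partial>\<gamma>)"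

definition kernel_iter ::
    "('a::polish_space \<Rightarrow> 'a measure) \<Rightarrow> nat \<Rightarrow> 'a \<Rightarrow> 'a measure" where
  "kernel_iter P k x = ((\<lambda>\<mu>. \<mu> \<bind> P) ^^ k) (return borel x)"

definition coarse_ricci ::
    "('a::polish_space \<Rightarrow> 'a measure) \<Rightarrow> nat \<Rightarrow> 'a \<Rightarrow> 'a \<Rightarrow> ereal" where
  "coarse_ricci P k x y = (if x = y then 1
     else 1 - enn2ereal (W1 (kernel_iter P k x) (kernel_iter P k y)) / ereal (dist x y))"

definition coarse_ricci_inf :: "('a::polish_space \<Rightarrow> 'a measure) \<Rightarrow> nat \<Rightarrow> ereal" where
  "coarse_ricci_inf P k = (INF x. INF y. coarse_ricci P k x y)"

definition max_expansion :: "('a::polish_space \<Rightarrow> 'a measure) \<Rightarrow> ereal" where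
  "max_expansion P = (SUP k. 1 - coarse_ricci_inf P k)"

definition supp :: "'a::polish_space measure \<Rightarrow> 'a set" where
  "supp \<mu> = {x. \<forall>U. open U \<longrightarrow> x \<in> U \<longrightarrow> 0 < emeasure \<mu> U}"

definition ennreal_sqrt :: "ennreal \<Rightarrow> ennreal" where
  "ennreal_sqrt a = (if a = \<infinity> then \<infinity> else ennreal (sqrt (enn2real a)))"

definition coarse_diffusion ::
    "('a::polish_space \<Rightarrow> 'a measure) \<Rightarrow> 'a \<Rightarrow> ennreal" where
  "coarse_diffusion P x =
     ennreal_sqrt ((\<integral>\<^sup>+ z. (\<integral>\<^sup>+ y. ennreal ((dist y z)\<^sup>2) \<partial>P x) \<partial>P x) / 2)"

text \<open>If \<open>f\<close> is not integrable, then neither is its square, and the value is \<open>\<infinity>\<close>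
  (for a probability measure \<open>\<mu>\<close>).\<close>

definition evariance :: "'a measure \<Rightarrow> ('a \<Rightarrow> real) \<Rightarrow> ennreal" where
  "evariance \<mu> f = (\<integral>\<^sup>+ y. ennreal ((f y - (\<integral>z. f z \<partial>\<mu>))\<^sup>2) \<partial>\<mu>)"

text \<open>Restricting the measure to its support makes the values of \<open>f\<close> (and its
  measurability) outside the support irrelevant, so the supremum is over functions defined
  on the support only.\<close>

definition Lipschitz_variance_sup :: "'a::polish_space measure \<Rightarrow> ennreal" where
  "Lipschitz_variance_sup \<mu> =
     (SUP f\<in>{f :: 'a \<Rightarrow> real. 1-lipschitz_on (supp \<mu>) f}.
        evariance (restrict_space \<mu> (supp \<mu>)) f)"

text \<open>When \<open>\<sigma>(x) = 0\<close>, the measure \<open>P x\<close> is a Dirac mass, the supremum is also \<open>0\<close>, and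
  \<open>0 / 0 = 0\<close> in \<^typ>\<open>ennreal\<close>; thus \<open>\<sigma>(x)\<^sup>2 / n(x)\<close> evaluates to that supremum in this
  case too.\<close>

definition local_dimension ::
    "('a::polish_space \<Rightarrow> 'a measure) \<Rightarrow> 'a \<Rightarrow> ennreal" where
  "local_dimension P x = (coarse_diffusion P x)\<^sup>2 / Lipschitz_variance_sup (P x)"

definition ediameter :: "'a::metric_space set \<Rightarrow> ennreal" where
  "ediameter A = (SUP y\<in>A. SUP z\<in>A. ennreal (dist y z))"

definition granularity :: "('a::polish_space \<Rightarrow> 'a measure) \<Rightarrow> ennreal" where
  "granularity P = (SUP x. ediameter (supp (P x)) / 2)"

definition Lip_coeff :: "('a::metric_space \<Rightarrow> real) \<Rightarrow> real" where
  "Lip_coeff f = Inf {L. L-lipschitz_on UNIV f}"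

end

theory Submission
  imports Defs
begin

text \<open>
  Write \<open>T g x = \<integral> g dP\<^sub>x\<close>. If \<open>g\<close> is \<open>a\<close>-Lipschitz with \<open>2 a \<sigma>\<^sub>\<infinity> \<le> 1\<close>, then
  \<open>e\<^sup>u \<le> 1 + u + u\<^sup>2\<close> for \<open>\<bar>u\<bar> \<le> 1\<close> gives \<open>T e\<^sup>g \<le> exp (T g + a\<^sup>2 S)\<close>. By stationarity,
  \<open>E e\<^sup>g\<close> therefore does not decrease when \<open>g\<close> is replaced by \<open>T g + a\<^sup>2 S\<close>. Starting from
  \<open>\<theta> f\<close>, the \<open>n\<close>-th iterate has Lipschitz constant at most
  \<open>a\<^sub>n = 2 \<theta> M L (1 - \<kappa> / 2) ^ (n div K)\<close>: the contribution of \<open>f\<close> contracts at rate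
  \<open>1 - \<kappa>\<close> every \<open>K\<close> steps, and the restriction on \<open>\<theta>\<close> keeps that of \<open>S\<close> below the slower
  rate \<open>1 - \<kappa> / 2\<close>. So the iterates become constant, the constant being the limit
  \<open>\<theta> E f + (\<Sum>n. a\<^sub>n\<^sup>2) E S\<close> of their means, and \<open>\<Sum>n. a\<^sub>n\<^sup>2 \<le> 4 \<theta>\<^sup>2 M\<^sup>2 L\<^sup>2 K / (\<kappa> - \<kappa>\<^sup>2 / 4)\<close>.

  All integrals are kept finite by working with bounded functions: \<open>S\<close> may be replaced by
  \<open>min S ((2 \<sigma>\<^sub>\<infinity>)\<^sup>2)\<close>, because the variance of a \<open>1\<close>-Lipschitz function under \<open>P\<^sub>x\<close> never exceeds
  \<open>(2 \<sigma>\<^sub>\<infinity>)\<^sup>2\<close>, and \<open>f\<close> by its truncations. The bounds for \<open>f\<close> and \<open>- f\<close> together are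
  uniform in the truncation level even though the means of the truncations are not known to be
  bounded, whence \<open>f\<close> is exponentially integrable.
\<close>

subsection \<open>Elementary inequalities\<close>

text \<open>For \<open>u = - w < 0\<close> the claim amounts to
  \<open>1 \<le> (1 - w + w\<^sup>2) * exp w\<close>. It follows from the Taylor minorant
  \<open>1 + w + w\<^sup>2/2\<close> of \<open>exp w\<close>, since the product of the two
  polynomials is 1 plus terms with nonnegative coefficients.\<close>

lemma exp_le_quadratic:
  fixes u :: real
  assumes "\<bar>u\<bar> \<le> 1"
  shows "exp u \<le> 1 + u + u\<^sup>2"
proof (cases "0 \<le> u")
  case True
  then show ?thesis using assms exp_bound by simp
next
  case False
  define w where "w = - u"
  have w: "0 < w" "w \<le> 1" using False assms by (auto simp: w_def)
  have "1 + w + w\<^sup>2/2 \<le> exp w"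
    using w exp_lower_Taylor_quadratic[of w] by simp
  moreover have "1 \<le> (1 - w + w\<^sup>2) * (1 + w + w\<^sup>2/2)"
  proof -
    have "(1 - w + w\<^sup>2) * (1 + w + w\<^sup>2/2) = 1 + w\<^sup>2/2 + w^3/2 + w^4/2"
      by (simp add: field_simps power2_eq_square power3_eq_cube power4_eq_xxxx)
    then show ?thesis using w by simp
  qed
  moreover have "0 < 1 - w + w\<^sup>2" using w by (simp add: add_pos_nonneg add_nonneg_pos)
  ultimately have "1 \<le> (1 - w + w\<^sup>2) * exp w"
    by (meson less_imp_le mult_left_mono order_trans)
  then have "exp (- w) \<le> 1 - w + w\<^sup>2"
    by (simp add: exp_minus field_simps)
  then show ?thesis by (simp add: w_def)
qed

text \<open>Up to scaling, the left side bounds the Lipschitz constant of the \<open>n\<close>-th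
  iterate: the last summand is what remains of \<open>f\<close>, the sum collects the contributions
  of \<open>S\<close>. The induction goes in strides of \<open>K\<close>: passing from
  \<open>m\<close> to \<open>m + K\<close> multiplies the old terms by \<open>u\<close> and adds
  \<open>K\<close> fresh ones.\<close>

lemma block_sum_bound:
  fixes \<kappa> :: real and K n :: nat
  assumes "0 < \<kappa>" "\<kappa> \<le> 1" "0 < K"
  defines "u \<equiv> 1 - \<kappa>" and "v \<equiv> 1 - \<kappa> / 2"
  shows "\<kappa> / K * (\<Sum>j<n. (v ^ (j div K))\<^sup>2 * u ^ ((n - 1 - j) div K)) + u ^ (n div K)
    \<le> 2 * v ^ (n div K)"
    (is "?h n \<le> _")
proof (induction n rule: less_induct)
  case (less n)
  have u: "0 \<le> u" "u \<le> 1" and v: "0 < v" "v \<le> 1" using assms by auto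
  show ?case
  proof (cases "n < K")
    case True
    \<comment> \<open>Below \<open>K\<close> all quotients by \<open>K\<close> are 0, so every
      summand is 1 and the left side is at most 2.\<close>
    have "(\<Sum>j<n. (v ^ (j div K))\<^sup>2 * u ^ ((n - 1 - j) div K)) = (\<Sum>j<n. 1)"
      using True by (intro sum.cong) auto
    moreover have "\<kappa> / K * n \<le> 1"
    proof -
      have "\<kappa> / K * n \<le> 1 / K * K" using True assms by (intro mult_mono divide_right_mono) auto
      then show ?thesis using assms by simp
    qed
    ultimately show ?thesis using True by simp
  next
    case False
    define m where "m = n - K"
    have n: "n = m + K" using False by (simp add: m_def)
    have dm: "n div K = Suc (m div K)" using n assms by simp
    let ?s = "\<lambda>n j. (v ^ (j div K))\<^sup>2 * u ^ ((n - 1 - j) div K)"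
    let ?w = "v ^ (m div K)"
    have "(\<Sum>j<n. ?s n j) = (\<Sum>j<m. ?s n j) + (\<Sum>j=m..<n. ?s n j)"
      using n by (simp add: lessThan_atLeast0 sum.atLeastLessThan_concat)
    also have "(\<Sum>j<m. ?s n j) = u * (\<Sum>j<m. ?s m j)"
      unfolding sum_distrib_left
    proof (rule sum.cong)
      fix j assume "j \<in> {..<m}"
      then have "n - 1 - j = (m - 1 - j) + K" using n by auto
      then have "(n - 1 - j) div K = Suc ((m - 1 - j) div K)" using assms by simp
      then show "?s n j = u * ?s m j" by simp
    qed simp
    also have "(\<Sum>j=m..<n. ?s n j) \<le> (\<Sum>j=m..<n. ?w\<^sup>2)"
    proof (rule sum_mono)
      fix j assume j: "j \<in> {m..<n}"
      have "v ^ (j div K) \<le> ?w" using v j by (intro power_decreasing div_le_mono) auto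
      then have "(v ^ (j div K))\<^sup>2 \<le> ?w\<^sup>2" using v by (intro power_mono) auto
      moreover have "(n - 1 - j) div K = 0" using n j by auto
      ultimately show "?s n j \<le> ?w\<^sup>2" by simp
    qed
    also have "(\<Sum>j=m..<n. ?w\<^sup>2) = K * ?w\<^sup>2" using n by simp
    finally have "\<kappa> / K * (\<Sum>j<n. ?s n j) \<le> \<kappa> / K * (u * (\<Sum>j<m. ?s m j) + K * ?w\<^sup>2)"
      using assms by (intro mult_left_mono) auto
    also have "\<dots> = u * (\<kappa> / K * (\<Sum>j<m. ?s m j)) + \<kappa> * ?w\<^sup>2"
      using \<open>0 < K\<close> by (simp add: distrib_left mult.left_commute)
    finally have "?h n \<le> u * ?h m + \<kappa> * ?w\<^sup>2" by (simp add: dm algebra_simps)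
    \<comment> \<open>The slower rate appears here:
      \<open>2 * (1 - \<kappa>) + \<kappa> = 2 * (1 - \<kappa> / 2)\<close>.\<close>
    also have "\<dots> \<le> u * (2 * ?w) + \<kappa> * ?w"
    proof (intro add_mono mult_left_mono)
      show "?h m \<le> 2 * ?w" using less n assms by simp
      show "?w\<^sup>2 \<le> ?w" using v by (simp add: power2_eq_square mult_left_le power_le_one)
    qed (use u assms in auto)
    also have "\<dots> = 2 * v ^ (n div K)" by (simp add: dm u_def v_def algebra_simps)
    finally show ?thesis .
  qed
qed

text \<open>Exponents are constant on blocks of length \<open>K\<close>, so \<open>q\<close> full
  blocks give \<open>K\<close> times a geometric sum of ratio \<open>v\<^sup>2\<close>. Padding
  \<open>n\<close> to \<open>n * K\<close> avoids an incomplete last block.\<close>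

lemma block_geometric_sum_le:
  fixes v :: real and K n :: nat
  assumes "0 < v" "v < 1" "0 < K"
  shows "(\<Sum>j<n. (v ^ (j div K))\<^sup>2) \<le> K / (1 - v\<^sup>2)"
proof -
  have v2: "0 < v\<^sup>2" "v\<^sup>2 < 1" using assms by (auto simp: power_less_one_iff)
  have blocks: "(\<Sum>j<q * K. (v ^ (j div K))\<^sup>2) = K * (\<Sum>i<q. (v\<^sup>2) ^ i)" for q
  proof (induction q)
    case (Suc q)
    have "(\<Sum>j<Suc q * K. (v ^ (j div K))\<^sup>2)
        = (\<Sum>j<q * K. (v ^ (j div K))\<^sup>2) + (\<Sum>j=q * K..<Suc q * K. (v ^ (j div K))\<^sup>2)"
      by (simp add: lessThan_atLeast0 sum.atLeastLessThan_concat)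
    also have "(\<Sum>j=q * K..<Suc q * K. (v ^ (j div K))\<^sup>2) = (\<Sum>j=q * K..<Suc q * K. (v\<^sup>2) ^ q)"
    proof (rule sum.cong)
      fix j assume "j \<in> {q * K..<Suc q * K}"
      then have "j div K = q" by (intro div_nat_eqI) (auto simp: mult.commute)
      then show "(v ^ (j div K))\<^sup>2 = (v\<^sup>2) ^ q" by (simp flip: power_mult add: mult.commute)
    qed simp
    finally show ?case using Suc by (simp add: algebra_simps)
  qed simp
  have "n \<le> n * K" using assms by simp
  then have "(\<Sum>j<n. (v ^ (j div K))\<^sup>2) \<le> (\<Sum>j<n * K. (v ^ (j div K))\<^sup>2)"
    by (intro sum_mono2) auto
  also have "\<dots> = K * ((1 - (v\<^sup>2) ^ n) / (1 - v\<^sup>2))"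
    using v2 by (simp add: blocks sum_gp_strict)
  also have "\<dots> \<le> K * (1 / (1 - v\<^sup>2))"
    using v2 by (intro mult_left_mono divide_right_mono) auto
  finally show ?thesis by simp
qed

subsection \<open>Support and Lipschitz variance\<close>

lemma closed_supp: "closed (supp \<mu>)"
proof -
  have "- supp \<mu> = \<Union>{U. open U \<and> emeasure \<mu> U = 0}"
    by (auto simp: supp_def zero_less_iff_neq_zero)
  then show ?thesis by (auto simp: closed_def intro!: open_Union)
qed

text \<open>Every point outside the support has a null open neighbourhood, which can be shrunk to a
  member of a countable basis; so countably many null sets cover the complement.\<close>

lemma AE_supp:
  assumes "sets \<mu> = sets borel"
  shows "AE x in \<mu>. x \<in> supp \<mu>"
proof -
  obtain B :: "'a set set" where B: "countable B" "topological_basis B"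
    using ex_countable_basis by blast
  define N where "N = (\<Union>U\<in>{U \<in> B. emeasure \<mu> U = 0}. U)"
  have "N \<in> null_sets \<mu>"
    unfolding N_def
  proof (rule null_sets_UN')
    show "countable {U \<in> B. emeasure \<mu> U = 0}"
      using B(1) by (rule countable_subset[rotated]) blast
    fix U assume "U \<in> {U \<in> B. emeasure \<mu> U = 0}"
    then show "U \<in> null_sets \<mu>"
      using topological_basis_open[OF B(2)] assms by (simp add: null_sets_def)
  qed
  moreover have "{x \<in> space \<mu>. x \<notin> supp \<mu>} \<subseteq> N"
  proof
    fix x assume "x \<in> {x \<in> space \<mu>. x \<notin> supp \<mu>}"
    then obtain U where U: "open U" "x \<in> U" "emeasure \<mu> U = 0"
      by (auto simp: supp_def zero_less_iff_neq_zero)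
    obtain V where V: "V \<in> B" "x \<in> V" "V \<subseteq> U"
      using topological_basisE[OF B(2) U(1,2)] by metis
    have "emeasure \<mu> V \<le> emeasure \<mu> U" using V U assms by (intro emeasure_mono) auto
    then show "x \<in> N" using U V by (auto simp: N_def)
  qed
  ultimately show ?thesis by (rule AE_I')
qed

lemma dist_supp_le:
  assumes "granularity P < \<infinity>" "y \<in> supp (P x)" "z \<in> supp (P x)"
  shows "dist y z \<le> 2 * enn2real (granularity P)"
proof -
  have "ennreal (dist y z) \<le> ediameter (supp (P x))"
    unfolding ediameter_def using assms(2,3) by (meson SUP_upper2 order_refl)
  moreover have "ediameter (supp (P x)) / 2 \<le> granularity P"
    unfolding granularity_def by (rule SUP_upper) simp
  ultimately have "ennreal (dist y z) / 2 \<le> granularity P"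
    by (meson divide_right_mono_ennreal order_trans)
  then have "enn2real (ennreal (dist y z) / 2) \<le> enn2real (granularity P)"
    using assms by (intro enn2real_mono) auto
  moreover have "enn2real (ennreal (dist y z) / 2) = dist y z / 2"
    by (simp add: ennreal_divide_numeral)
  ultimately show ?thesis by simp
qed

lemma (in prob_space) square_expectation_le:
  fixes X :: "'a \<Rightarrow> real"
  assumes "integrable M X" "integrable M (\<lambda>x. (X x)\<^sup>2)"
  shows "(expectation X)\<^sup>2 \<le> expectation (\<lambda>x. (X x)\<^sup>2)"
  using variance_positive[of X] by (simp add: variance_eq assms)

lemma prob_space_restrict_supp:
  assumes "\<mu> \<in> space (prob_algebra borel)"
  shows "prob_space (restrict_space \<mu> (supp \<mu>))"
proof -
  have s: "sets \<mu> = sets borel" and p: "prob_space \<mu>"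
    using assms by (auto simp: space_prob_algebra)
  have sp: "space \<mu> = UNIV" using sets_eq_imp_space_eq[OF s] by simp
  have "emeasure \<mu> (supp \<mu>) = 1"
    using AE_supp[OF s] p closed_supp[of \<mu>] s
    by (intro prob_space.emeasure_eq_1_AE) auto
  then show ?thesis
    using closed_supp[of \<mu>] s sp
    by (intro prob_spaceI) (simp add: emeasure_restrict_space space_restrict_space)
qed

text \<open>The deviation of \<open>f y\<close> from the mean is the average of
  \<open>f y - f z\<close> over \<open>z\<close>, so Jensen's inequality and the Lipschitz bound
  dominate its square by an average of squared distances. The bound \<open>R\<close> makes
  \<open>f\<close> bounded on the support, hence integrable there.\<close>

lemma Lipschitz_variance_sup_le:
  fixes \<mu> :: "'a::polish_space measure"
  assumes \<mu>: "\<mu> \<in> space (prob_algebra borel)"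
    and R: "\<And>y z. y \<in> supp \<mu> \<Longrightarrow> z \<in> supp \<mu> \<Longrightarrow> dist y z \<le> R"
  shows "Lipschitz_variance_sup \<mu> \<le> (\<integral>\<^sup>+ z. (\<integral>\<^sup>+ y. ennreal ((dist y z)\<^sup>2) \<partial>\<mu>) \<partial>\<mu>)"
  unfolding Lipschitz_variance_sup_def
proof (rule SUP_least)
  fix f :: "'a \<Rightarrow> real" assume "f \<in> {f. 1-lipschitz_on (supp \<mu>) f}"
  then have f: "1-lipschitz_on (supp \<mu>) f" by simp
  have s: "sets \<mu> = sets borel" using \<mu> by (simp add: space_prob_algebra)
  have sp: "space \<mu> = UNIV" using sets_eq_imp_space_eq[OF s] by simp
  have clo: "supp \<mu> \<in> sets borel" using closed_supp[of \<mu>] by simp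
  define \<nu> where "\<nu> = restrict_space \<mu> (supp \<mu>)"
  interpret prob_space \<nu> unfolding \<nu>_def by (rule prob_space_restrict_supp[OF \<mu>])
  have sp\<nu>: "space \<nu> = supp \<mu>" by (simp add: \<nu>_def space_restrict_space sp)
  \<comment> \<open>Nothing is known about \<open>f\<close> off the support, so measurability is
    claimed for the restricted measure only.\<close>
  have "f \<in> borel_measurable (restrict_space borel (supp \<mu>))"
    using lipschitz_on_continuous_on[OF f] by (rule borel_measurable_continuous_on_restrict)
  also have "sets (restrict_space borel (supp \<mu>)) = sets \<nu>"
    by (simp add: \<nu>_def sets_restrict_space s)
  then have "borel_measurable (restrict_space borel (supp \<mu>)) = (borel_measurable \<nu> :: ('a \<Rightarrow> real) set)"
    by (intro measurable_cong_sets) auto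
  finally have [measurable]: "f \<in> borel_measurable \<nu>" .
  have fd: "\<bar>f y - f z\<bar> \<le> dist y z" if "y \<in> supp \<mu>" "z \<in> supp \<mu>" for y z
    using lipschitz_onD[OF f that] by (simp add: dist_real_def)
  obtain x0 where x0: "x0 \<in> supp \<mu>" using not_empty sp\<nu> by auto
  have bnd: "\<bar>f y - f z\<bar> \<le> R" if "y \<in> supp \<mu>" "z \<in> supp \<mu>" for y z
    using fd[OF that] R[OF that] by simp
  have int_f: "integrable \<nu> f"
  proof (rule integrable_const_bound[where B = "\<bar>f x0\<bar> + R"])
    show "AE x in \<nu>. norm (f x) \<le> \<bar>f x0\<bar> + R"
      using bnd[OF _ x0] by (intro AE_I2) (force simp: sp\<nu>)
  qed measurable
  have point: "ennreal ((f y - (\<integral>z. f z \<partial>\<nu>))\<^sup>2) \<le> (\<integral>\<^sup>+ z. ennreal ((dist z y)\<^sup>2) \<partial>\<mu>)"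
    if y: "y \<in> supp \<mu>" for y
  proof -
    have i1: "integrable \<nu> (\<lambda>z. f y - f z)" using int_f by simp
    have i2: "integrable \<nu> (\<lambda>z. (f y - f z)\<^sup>2)"
    proof (rule integrable_const_bound[where B = "R\<^sup>2"])
      show "AE x in \<nu>. norm ((f y - f x)\<^sup>2) \<le> R\<^sup>2"
      proof (rule AE_I2)
        fix x assume "x \<in> space \<nu>"
        then have "\<bar>f y - f x\<bar> \<le> R" using bnd y by (simp add: sp\<nu>)
        from power_mono[OF this, of 2] show "norm ((f y - f x)\<^sup>2) \<le> R\<^sup>2" by simp
      qed
    qed measurable
    have "(f y - (\<integral>z. f z \<partial>\<nu>))\<^sup>2 = (\<integral>z. f y - f z \<partial>\<nu>)\<^sup>2"
      using int_f by (simp add: prob_space)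
    also have "\<dots> \<le> (\<integral>z. (f y - f z)\<^sup>2 \<partial>\<nu>)"
      by (rule square_expectation_le[OF i1 i2])
    finally have "ennreal ((f y - (\<integral>z. f z \<partial>\<nu>))\<^sup>2) \<le> ennreal (\<integral>z. (f y - f z)\<^sup>2 \<partial>\<nu>)"
      by (rule ennreal_leI)
    also have "\<dots> = (\<integral>\<^sup>+z. ennreal ((f y - f z)\<^sup>2) \<partial>\<nu>)"
      using i2 by (intro nn_integral_eq_integral[symmetric]) auto
    also have "\<dots> \<le> (\<integral>\<^sup>+z. ennreal ((dist z y)\<^sup>2) \<partial>\<nu>)"
    proof (rule nn_integral_mono)
      fix x assume "x \<in> space \<nu>"
      then have "\<bar>f y - f x\<bar> \<le> dist x y" using fd[of y x] y by (simp add: sp\<nu> dist_commute)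
      from power_mono[OF this, of 2] show "ennreal ((f y - f x)\<^sup>2) \<le> ennreal ((dist x y)\<^sup>2)"
        by (intro ennreal_leI) simp
    qed
    also have "\<dots> \<le> (\<integral>\<^sup>+z. ennreal ((dist z y)\<^sup>2) \<partial>\<mu>)"
      unfolding \<nu>_def using clo s sp
      by (subst nn_integral_restrict_space) (auto intro!: nn_integral_mono simp: indicator_def)
    finally show ?thesis .
  qed
  have "evariance \<nu> f \<le> (\<integral>\<^sup>+ y. (\<integral>\<^sup>+ z. ennreal ((dist z y)\<^sup>2) \<partial>\<mu>) \<partial>\<nu>)"
    unfolding evariance_def by (rule nn_integral_mono) (use point sp\<nu> in auto)
  also have "\<dots> \<le> (\<integral>\<^sup>+ y. (\<integral>\<^sup>+ z. ennreal ((dist z y)\<^sup>2) \<partial>\<mu>) \<partial>\<mu>)"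
    unfolding \<nu>_def using clo s sp
    by (subst nn_integral_restrict_space) (auto intro!: nn_integral_mono simp: indicator_def)
  finally show "evariance (restrict_space \<mu> (supp \<mu>)) f
    \<le> (\<integral>\<^sup>+ y. (\<integral>\<^sup>+ z. ennreal ((dist z y)\<^sup>2) \<partial>\<mu>) \<partial>\<mu>)" by (simp add: \<nu>_def)
qed

text \<open>The cancellation needs care only in the degenerate cases of division in
  \<open>ennreal\<close>: finite granularity keeps everything finite, and
  \<open>Lipschitz_variance_sup_le\<close> makes the variance vanish together with the diffusion
  constant. The second claim is the cap used later to truncate \<open>S\<close>.\<close>

lemma diffusion_over_dimension:
  fixes P :: "'a::polish_space \<Rightarrow> 'a measure"
  assumes P: "P x \<in> space (prob_algebra borel)" and g: "granularity P < \<infinity>"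
  shows "(coarse_diffusion P x)\<^sup>2 / local_dimension P x = Lipschitz_variance_sup (P x)"
    and "Lipschitz_variance_sup (P x) \<le> ennreal ((2 * enn2real (granularity P))\<^sup>2)"
proof -
  define R where "R = 2 * enn2real (granularity P)"
  define I where "I = (\<integral>\<^sup>+ z. (\<integral>\<^sup>+ y. ennreal ((dist y z)\<^sup>2) \<partial>P x) \<partial>P x)"
  define V where "V = Lipschitz_variance_sup (P x)"
  have s: "sets (P x) = sets borel" and p: "prob_space (P x)"
    using P by (auto simp: space_prob_algebra)
  interpret prob_space "P x" by fact
  have R: "dist y z \<le> R" if "y \<in> supp (P x)" "z \<in> supp (P x)" for y z
    using dist_supp_le[OF g that] by (simp add: R_def)
  have VI: "V \<le> I"
    unfolding V_def I_def by (rule Lipschitz_variance_sup_le[OF P R])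
  have "I \<le> (\<integral>\<^sup>+ z. (\<integral>\<^sup>+ y. ennreal (R\<^sup>2) \<partial>P x) \<partial>P x)"
    unfolding I_def
  proof (rule nn_integral_mono_AE, use AE_supp[OF s] in eventually_elim)
    fix z assume z: "z \<in> supp (P x)"
    show "(\<integral>\<^sup>+ y. ennreal ((dist y z)\<^sup>2) \<partial>P x) \<le> (\<integral>\<^sup>+ y. ennreal (R\<^sup>2) \<partial>P x)"
    proof (rule nn_integral_mono_AE, use AE_supp[OF s] in eventually_elim)
      fix y assume "y \<in> supp (P x)"
      then show "ennreal ((dist y z)\<^sup>2) \<le> ennreal (R\<^sup>2)"
        using R z by (intro ennreal_leI power_mono) auto
    qed
  qed
  also have "\<dots> = ennreal (R\<^sup>2)" by (simp add: emeasure_space_1)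
  finally have IR: "I \<le> ennreal (R\<^sup>2)" .
  then show "Lipschitz_variance_sup (P x) \<le> ennreal ((2 * enn2real (granularity P))\<^sup>2)"
    using VI by (simp add: V_def R_def)
  have fin: "I / 2 < \<infinity>"
    using IR by (cases I) (auto simp: top_unique ennreal_divide_numeral)
  have sq: "(coarse_diffusion P x)\<^sup>2 = I / 2"
    using fin unfolding coarse_diffusion_def I_def[symmetric] ennreal_sqrt_def
    by (cases "I / 2") (auto simp: ennreal_power)
  have "I / 2 / (I / 2 / V) = V"
  proof (cases "I = 0")
    case True
    then show ?thesis using VI by simp
  next
    case I0: False
    show ?thesis
    proof (cases "V = 0")
      case True
      \<comment> \<open>Here the local dimension is infinite, and a finite number divided by it is
        0.\<close>
      then show ?thesis using I0 fin
        by (simp add: ennreal_divide_zero ennreal_divide_eq_0_iff)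
    next
      case False
      obtain i where i: "I = ennreal i" "0 \<le> i"
        using IR by (cases I) (auto simp: top_unique)
      obtain v where v: "V = ennreal v" "0 \<le> v"
        using IR VI by (cases V) (auto simp: top_unique i)
      have "0 < v" "0 < i" using False I0 i v by (auto simp: le_less)
      then show ?thesis by (simp add: i v divide_ennreal ennreal_divide_numeral)
    qed
  qed
  then show "(coarse_diffusion P x)\<^sup>2 / local_dimension P x = Lipschitz_variance_sup (P x)"
    by (simp add: local_dimension_def sq V_def)
qed

section \<open>Bounded Borel functions and their integrals\<close>

definition bounded_borel :: "('a::topological_space \<Rightarrow> real) \<Rightarrow> bool" where
  "bounded_borel g \<longleftrightarrow> g \<in> borel_measurable borel \<and> (\<exists>B. \<forall>x. \<bar>g x\<bar> \<le> B)"

lemma bounded_borelI: "g \<in> borel_measurable borel \<Longrightarrow> (\<And>x. \<bar>g x\<bar> \<le> B) \<Longrightarrow> bounded_borel g"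
  by (auto simp: bounded_borel_def)

lemma bounded_borelE:
  assumes "bounded_borel g"
  obtains B where "g \<in> borel_measurable borel" "\<And>x. \<bar>g x\<bar> \<le> B"
  using assms by (auto simp: bounded_borel_def)

lemma bounded_borel_add:
  assumes "bounded_borel f" "bounded_borel g"
  shows "bounded_borel (\<lambda>x. f x + g x)"
proof -
  obtain B C where "f \<in> borel_measurable borel" "\<And>x. \<bar>f x\<bar> \<le> B"
    "g \<in> borel_measurable borel" "\<And>x. \<bar>g x\<bar> \<le> C"
    using assms by (auto simp: bounded_borel_def)
  then show ?thesis
    by (intro bounded_borelI[where B = "B + C"])
      (auto intro: borel_measurable_add order_trans[OF abs_triangle_ineq] add_mono)
qed

lemma bounded_borel_cmult:
  assumes "bounded_borel f"
  shows "bounded_borel (\<lambda>x. c * f x)"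
proof -
  obtain B where "f \<in> borel_measurable borel" "\<And>x. \<bar>f x\<bar> \<le> B"
    using assms by (auto simp: bounded_borel_def)
  then show ?thesis
    by (intro bounded_borelI[where B = "\<bar>c\<bar> * B"]) (auto simp: abs_mult mult_left_mono)
qed

lemma bounded_borel_const: "bounded_borel (\<lambda>x. c)"
  by (auto simp: bounded_borel_def)

lemma bounded_borel_sum:
  "(\<And>i. i \<in> I \<Longrightarrow> bounded_borel (f i)) \<Longrightarrow> bounded_borel (\<lambda>x. \<Sum>i\<in>I. f i x)"
  by (induction I rule: infinite_finite_induct)
    (auto intro: bounded_borel_add bounded_borel_const)

lemma bounded_borel_exp:
  assumes "bounded_borel f"
  shows "bounded_borel (\<lambda>x. exp (f x))"
proof -
  obtain B where f: "f \<in> borel_measurable borel" "\<And>x. \<bar>f x\<bar> \<le> B"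
    using assms by (auto simp: bounded_borel_def)
  show ?thesis
  proof (rule bounded_borelI[where B = "exp B"])
    show "\<bar>exp (f x)\<bar> \<le> exp B" for x using f(2)[of x] by simp
  qed (use f in measurable)
qed

lemma bounded_borel_integrable:
  assumes "bounded_borel g" and \<mu>: "\<mu> \<in> space (prob_algebra borel)"
  shows "integrable \<mu> g"
proof -
  interpret prob_space \<mu> using \<mu> by (simp add: space_prob_algebra)
  have s: "sets \<mu> = sets borel" using \<mu> by (simp add: space_prob_algebra)
  obtain B where "g \<in> borel_measurable borel" "\<And>x. \<bar>g x\<bar> \<le> B"
    using assms(1) by (rule bounded_borelE) blast
  then show ?thesis
    by (intro integrable_const_bound[where B = B]) (auto simp: measurable_cong_sets[OF s refl])
qed

lemma bounded_borel_abs_integral_le: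
  assumes g: "bounded_borel g" "\<And>x. \<bar>g x\<bar> \<le> B" and \<mu>: "\<mu> \<in> space (prob_algebra borel)"
  shows "\<bar>\<integral>x. g x \<partial>\<mu>\<bar> \<le> B"
proof -
  interpret prob_space \<mu> using \<mu> by (simp add: space_prob_algebra)
  have i: "integrable \<mu> g" by (rule bounded_borel_integrable[OF g(1) \<mu>])
  have "\<bar>\<integral>x. g x \<partial>\<mu>\<bar> \<le> (\<integral>x. \<bar>g x\<bar> \<partial>\<mu>)" by (rule integral_abs_bound)
  also have "\<dots> \<le> (\<integral>x. B \<partial>\<mu>)" using i g(2) by (intro integral_mono) auto
  finally show ?thesis by (simp add: prob_space)
qed

lemma lipschitz_bounded_borel:
  fixes g :: "'a::polish_space \<Rightarrow> real"
  assumes "L-lipschitz_on UNIV g" "\<And>x. \<bar>g x\<bar> \<le> B"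
  shows "bounded_borel g"
  using assms lipschitz_on_continuous_on[OF assms(1)]
  by (auto intro!: bounded_borelI borel_measurable_continuous_onI)

subsection \<open>Contraction of Lipschitz functions\<close>

definition kernel_op :: "('a \<Rightarrow> 'a measure) \<Rightarrow> ('a \<Rightarrow> real) \<Rightarrow> 'a \<Rightarrow> real" where
  "kernel_op P g = (\<lambda>x. \<integral>y. g y \<partial>P x)"

text \<open>This is the easy half of Kantorovich-Rubinstein duality:
  \<open>g (fst p) - g (snd p)\<close> is integrated against a coupling. A near-optimal coupling
  with slack \<open>e\<close> is enough, so attainment of the infimum is not at issue.\<close>

lemma abs_integral_diff_le_W1:
  fixes g :: "'a::polish_space \<Rightarrow> real"
  assumes g: "bounded_borel g" "L-lipschitz_on UNIV g" and c: "W1 \<mu> \<nu> \<le> ennreal c" "0 \<le> c"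
  shows "\<bar>(\<integral>x. g x \<partial>\<mu>) - (\<integral>x. g x \<partial>\<nu>)\<bar> \<le> L * c"
proof (rule field_le_epsilon)
  fix e :: real assume e: "0 < e"
  have L: "0 \<le> L" using lipschitz_on_nonneg[OF g(2)] .
  \<comment> \<open>The denominator \<open>L + 1\<close> covers \<open>L = 0\<close> and still gives
    \<open>L * (e / (L + 1)) \<le> e\<close>.\<close>
  define c' where "c' = c + e / (L + 1)"
  have "c < c'" using e L by (simp add: c'_def)
  then have "W1 \<mu> \<nu> < ennreal c'"
    using c by (intro le_less_trans[OF c(1)] ennreal_lessI) auto
  then obtain \<gamma> where \<gamma>: "\<gamma> \<in> couplings \<mu> \<nu>"
    and cost: "(\<integral>\<^sup>+ p. ennreal (dist (fst p) (snd p)) \<partial>\<gamma>) < ennreal c'"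
    unfolding W1_def INF_less_iff by blast
  have s: "sets \<gamma> = sets (borel \<Otimes>\<^sub>M borel)" and p: "prob_space \<gamma>"
    and marg: "\<mu> = distr \<gamma> borel fst" "\<nu> = distr \<gamma> borel snd"
    using \<gamma> by (auto simp: couplings_def space_prob_algebra)
  interpret prob_space \<gamma> by fact
  obtain B where gm: "g \<in> borel_measurable borel" and gB: "\<And>x. \<bar>g x\<bar> \<le> B"
    using g(1) by (rule bounded_borelE) blast
  have [measurable]: "fst \<in> \<gamma> \<rightarrow>\<^sub>M borel" "snd \<in> \<gamma> \<rightarrow>\<^sub>M borel"
    by (simp_all add: measurable_cong_sets[OF s refl])
  have [measurable]: "(\<lambda>p. g (fst p)) \<in> borel_measurable \<gamma>" "(\<lambda>p. g (snd p)) \<in> borel_measurable \<gamma>"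
    by (rule measurable_compose[OF _ gm]; measurable)+
  have i: "integrable \<gamma> (\<lambda>p. g (fst p))" "integrable \<gamma> (\<lambda>p. g (snd p))"
    by (rule integrable_const_bound[where B = B]; simp add: gB)+
  have "(\<integral>x. g x \<partial>\<mu>) - (\<integral>x. g x \<partial>\<nu>) = (\<integral>p. g (fst p) - g (snd p) \<partial>\<gamma>)"
    using i gm by (simp add: marg integral_distr)
  then have "ennreal \<bar>(\<integral>x. g x \<partial>\<mu>) - (\<integral>x. g x \<partial>\<nu>)\<bar> \<le> (\<integral>\<^sup>+p. ennreal \<bar>g (fst p) - g (snd p)\<bar> \<partial>\<gamma>)"
    using integral_norm_bound_ennreal[of \<gamma> "\<lambda>p. g (fst p) - g (snd p)"] i by simp
  also have "\<dots> \<le> (\<integral>\<^sup>+p. ennreal L * ennreal (dist (fst p) (snd p)) \<partial>\<gamma>)"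
    using lipschitz_onD[OF g(2)] L
    by (intro nn_integral_mono) (simp add: dist_real_def ennreal_leI flip: ennreal_mult)
  also have "\<dots> = ennreal L * (\<integral>\<^sup>+p. ennreal (dist (fst p) (snd p)) \<partial>\<gamma>)"
    by (rule nn_integral_cmult) measurable
  also have "\<dots> \<le> ennreal L * ennreal c'" using cost by (intro mult_left_mono) auto
  also have "\<dots> = ennreal (L * c')" using L \<open>c < c'\<close> c by (simp add: ennreal_mult)
  finally have "\<bar>(\<integral>x. g x \<partial>\<mu>) - (\<integral>x. g x \<partial>\<nu>)\<bar> \<le> L * c'"
    using L \<open>c < c'\<close> c by (subst (asm) ennreal_le_iff) auto
  also have "L * c' \<le> L * c + e"
    using L e by (simp add: c'_def field_simps)
  finally show "\<bar>(\<integral>x. g x \<partial>\<mu>) - (\<integral>x. g x \<partial>\<nu>)\<bar> \<le> L * c + e" .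
qed

lemma W1_le_of_coarse_ricci_inf:
  fixes P :: "'a::polish_space \<Rightarrow> 'a measure"
  assumes c: "1 - coarse_ricci_inf P k \<le> ereal c" and xy: "x \<noteq> y"
  shows "W1 (kernel_iter P k x) (kernel_iter P k y) \<le> ennreal (c * dist x y)"
proof -
  let ?W = "W1 (kernel_iter P k x) (kernel_iter P k y)"
  have d: "0 < dist x y" using xy by simp
  have "coarse_ricci_inf P k \<le> coarse_ricci P k x y"
    unfolding coarse_ricci_inf_def by (meson INF_lower UNIV_I order_trans)
  then have "1 - coarse_ricci P k x y \<le> ereal c"
    using c by (meson ereal_minus_mono order_refl order_trans)
  then have 1: "1 - (1 - enn2ereal ?W / ereal (dist x y)) \<le> ereal c"
    using xy by (simp add: coarse_ricci_def)
  \<comment> \<open>An infinite transport cost would make the curvature of the pair minus infinity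
    and the left side of fact \<open>1\<close> infinite, against the real bound
    \<open>c\<close>.\<close>
  have "?W \<noteq> \<top>"
  proof
    assume "?W = \<top>"
    with 1 d show False by (simp add: one_ereal_def)
  qed
  then obtain w where w: "?W = ennreal w" "0 \<le> w" by (cases ?W) auto
  have "w / dist x y \<le> c"
    using 1 d w by (simp add: one_ereal_def)
  then have "w \<le> c * dist x y" using d by (simp add: field_simps)
  then show ?thesis by (simp add: w ennreal_leI)
qed

text \<open>The infimum is attained: every difference quotient is a lower bound of the set of
  admissible constants.\<close>

lemma Lip_coeff_lipschitz:
  fixes f :: "'a::metric_space \<Rightarrow> real"
  assumes "\<exists>L. L-lipschitz_on UNIV f"
  shows "(Lip_coeff f)-lipschitz_on UNIV f"
proof -
  let ?A = "{L. L-lipschitz_on UNIV f}"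
  have ne: "?A \<noteq> {}" using assms by auto
  show ?thesis
  proof (rule lipschitz_onI)
    show "0 \<le> Lip_coeff f"
      unfolding Lip_coeff_def using ne by (rule cInf_greatest) (auto dest: lipschitz_on_nonneg)
    fix x y :: 'a
    show "dist (f x) (f y) \<le> Lip_coeff f * dist x y"
    proof (cases "x = y")
      case False
      have "dist (f x) (f y) / dist x y \<le> Lip_coeff f"
        unfolding Lip_coeff_def using ne
      proof (rule cInf_greatest)
        fix L assume "L \<in> ?A"
        then have "dist (f x) (f y) \<le> L * dist x y" by (auto dest: lipschitz_onD)
        then show "dist (f x) (f y) / dist x y \<le> L" using False by (simp add: field_simps)
      qed
      then show ?thesis using False by (simp add: field_simps)
    qed simp
  qed
qed

section \<open>The Markov operator and the iterated kernel\<close>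

locale markov_kernel =
  fixes P :: "'a::polish_space \<Rightarrow> 'a measure"
  assumes kernel: "P \<in> borel \<rightarrow>\<^sub>M prob_algebra borel"
begin

abbreviation T :: "('a \<Rightarrow> real) \<Rightarrow> 'a \<Rightarrow> real" where "T \<equiv> kernel_op P"

lemma kernel_prob: "P x \<in> space (prob_algebra borel)"
  using measurable_space[OF kernel, of x] by simp

lemma kernel_op_bounded:
  assumes "bounded_borel g" "\<And>x. \<bar>g x\<bar> \<le> B"
  shows "bounded_borel (T g)" "\<bar>T g x\<bar> \<le> B"
proof -
  have gm: "g \<in> borel_measurable borel" using assms(1) by (simp add: bounded_borel_def)
  show b: "\<bar>T g x\<bar> \<le> B" for x
    unfolding kernel_op_def by (rule bounded_borel_abs_integral_le[OF assms kernel_prob])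
  have "T g \<in> borel_measurable borel"
    unfolding kernel_op_def
    by (rule measurable_compose[OF measurable_prob_algebraD[OF kernel]
          integral_measurable_subprob_algebra[OF gm]])
  then show "bounded_borel (T g)" using b by (rule bounded_borelI)
qed

lemma kernel_op_pow_bounded:
  assumes "bounded_borel g" "\<And>x. \<bar>g x\<bar> \<le> B"
  shows "bounded_borel ((T ^^ n) g)" "\<bar>(T ^^ n) g x\<bar> \<le> B"
proof -
  have "bounded_borel ((T ^^ n) g) \<and> (\<forall>x. \<bar>(T ^^ n) g x\<bar> \<le> B)"
    by (induction n) (use assms kernel_op_bounded in auto)
  then show "bounded_borel ((T ^^ n) g)" "\<bar>(T ^^ n) g x\<bar> \<le> B" by auto
qed

lemma bounded_borel_kernel_op_pow: "bounded_borel g \<Longrightarrow> bounded_borel ((T ^^ n) g)"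
  by (elim bounded_borelE) (rule kernel_op_pow_bounded, auto intro: bounded_borelI)

lemma kernel_op_add:
  "bounded_borel f \<Longrightarrow> bounded_borel g \<Longrightarrow> T (\<lambda>x. f x + g x) = (\<lambda>x. T f x + T g x)"
  by (simp add: kernel_op_def bounded_borel_integrable[OF _ kernel_prob])

lemma kernel_op_cmult: "T (\<lambda>x. c * f x) = (\<lambda>x. c * T f x)"
  by (simp add: kernel_op_def)

lemma kernel_op_sum:
  "(\<And>i. i \<in> I \<Longrightarrow> bounded_borel (f i)) \<Longrightarrow> T (\<lambda>x. \<Sum>i\<in>I. f i x) = (\<lambda>x. \<Sum>i\<in>I. T (f i) x)"
  by (simp add: kernel_op_def bounded_borel_integrable[OF _ kernel_prob])

lemma integral_bind_kernel:
  assumes g: "bounded_borel g" and \<mu>: "\<mu> \<in> space (prob_algebra borel)"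
  shows "(\<integral>x. g x \<partial>(\<mu> \<bind> P)) = (\<integral>x. T g x \<partial>\<mu>)"
proof -
  obtain B where gm: "g \<in> borel_measurable borel" and gB: "\<And>x. \<bar>g x\<bar> \<le> B"
    using g by (rule bounded_borelE) blast
  have s: "sets \<mu> = sets borel" and p: "prob_space \<mu>" using \<mu> by (auto simp: space_prob_algebra)
  have "P \<in> \<mu> \<rightarrow>\<^sub>M subprob_algebra borel"
    using measurable_prob_algebraD[OF kernel] by (simp add: measurable_cong_sets[OF s refl])
  moreover have "emeasure (P x) (space (P x)) \<le> ennreal 1" for x
    using kernel_prob[of x] prob_space.emeasure_space_1[of "P x"] by (auto simp: space_prob_algebra)
  ultimately show ?thesis
    unfolding kernel_op_def using p gm gB
    by (intro integral_bind[where K = borel and B = B and B' = 1])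
      (auto intro: prob_space.finite_measure)
qed

lemma kernel_iter_prob: "kernel_iter P k x \<in> space (prob_algebra borel)"
proof (induction k)
  case 0
  show ?case by (simp add: kernel_iter_def space_prob_algebra prob_space_return)
next
  case (Suc k)
  then show ?case
    using prob_space_bind'[OF Suc kernel] sets_bind'[OF Suc kernel]
    by (simp add: kernel_iter_def space_prob_algebra)
qed

text \<open>Moving measures forward is dual to averaging functions. The induction varies
  \<open>g\<close> because peeling off the last step of the kernel replaces \<open>g\<close> by
  \<open>T g\<close>.\<close>

lemma integral_kernel_iter:
  "bounded_borel g \<Longrightarrow> (\<integral>y. g y \<partial>kernel_iter P k x) = (T ^^ k) g x"
proof (induction k arbitrary: g)
  case 0
  then show ?case by (simp add: kernel_iter_def integral_return bounded_borel_def)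
next
  case (Suc k)
  have "(\<integral>y. g y \<partial>kernel_iter P (Suc k) x) = (\<integral>y. T g y \<partial>kernel_iter P k x)"
    using integral_bind_kernel[OF Suc.prems kernel_iter_prob] by (simp add: kernel_iter_def)
  also have "\<dots> = (T ^^ k) (T g) x"
    using bounded_borel_kernel_op_pow[OF Suc.prems, of 1] by (intro Suc.IH) simp
  finally show ?case by (simp add: funpow_swap1)
qed

text \<open>Curvature turns into contraction here. The lemma serves twice: with \<open>c = M\<close>
  for any number of steps, and with \<open>c = 1 - \<kappa>\<close> for \<open>K\<close>
  steps.\<close>

lemma kernel_op_pow_lipschitz:
  assumes c: "1 - coarse_ricci_inf P k \<le> ereal c" "0 \<le> c"
    and g: "bounded_borel g" "L-lipschitz_on UNIV g"
  shows "(c * L)-lipschitz_on UNIV ((T ^^ k) g)"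
proof (rule lipschitz_onI)
  show "0 \<le> c * L" using c lipschitz_on_nonneg[OF g(2)] by simp
  fix x y :: 'a
  show "dist ((T ^^ k) g x) ((T ^^ k) g y) \<le> c * L * dist x y"
  proof (cases "x = y")
    case False
    have "W1 (kernel_iter P k x) (kernel_iter P k y) \<le> ennreal (c * dist x y)"
      by (rule W1_le_of_coarse_ricci_inf[OF c(1) False])
    from abs_integral_diff_le_W1[OF g this] show ?thesis
      using c by (simp add: integral_kernel_iter[OF g(1)] dist_real_def mult_ac)
  qed simp
qed

end

subsection \<open>Laplace transform of bounded functions\<close>

context markov_kernel
begin

text \<open>On the support of \<open>P x\<close>, whose diameter is at most twice the granularity,
  \<open>g\<close> stays within 1 of its mean \<open>m = T g x\<close>. So
  \<open>exp_le_quadratic\<close> applies to \<open>g y - m\<close>; on integration the linear term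
  vanishes, the quadratic one is a variance, and \<open>1 + z \<le> exp z\<close> finishes.\<close>

lemma kernel_op_exp_le:
  assumes g: "bounded_borel g" "a-lipschitz_on UNIV g"
    and fin: "granularity P < \<infinity>" and a: "0 < a" "a * (2 * enn2real (granularity P)) \<le> 1"
    and s: "Lipschitz_variance_sup (P x) \<le> ennreal s" "0 \<le> s"
  shows "T (\<lambda>y. exp (g y)) x \<le> exp (T g x + a\<^sup>2 * s)"
proof -
  define m where "m = T g x"
  have sets: "sets (P x) = sets borel" and p: "prob_space (P x)"
    using kernel_prob[of x] by (auto simp: space_prob_algebra)
  have sp: "space (P x) = UNIV" using sets_eq_imp_space_eq[OF sets] by simp
  interpret prob_space "P x" by fact
  note AE = AE_supp[OF sets]
  note bi = bounded_borel_integrable[OF _ kernel_prob[of x]]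
  have clo: "supp (P x) \<in> sets (P x)" using closed_supp[of "P x"] sets by simp
  have ig: "integrable (P x) g" by (rule bi[OF g(1)])
  have [measurable]: "g \<in> borel_measurable (P x)" using ig by simp
  have near: "\<bar>g y - m\<bar> \<le> 1" if y: "y \<in> supp (P x)" for y
  proof -
    have "\<bar>g y - m\<bar> = \<bar>\<integral>z. g y - g z \<partial>P x\<bar>"
      using ig by (simp add: m_def kernel_op_def prob_space)
    also have "\<dots> \<le> (\<integral>z. \<bar>g y - g z\<bar> \<partial>P x)" by (rule integral_abs_bound)
    also have "\<dots> \<le> (\<integral>z. 1 \<partial>P x)"
    proof (rule integral_mono_AE)
      show "AE z in P x. \<bar>g y - g z\<bar> \<le> 1"
        using AE
      proof eventually_elim
        case (elim z)
        have "\<bar>g y - g z\<bar> \<le> a * dist y z"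
          using lipschitz_onD[OF g(2)] by (simp add: dist_real_def)
        also have "\<dots> \<le> a * (2 * enn2real (granularity P))"
          using dist_supp_le[OF fin y elim] a by (intro mult_left_mono) auto
        finally show ?case using a by simp
      qed
    qed (use ig in auto)
    finally show ?thesis by (simp add: prob_space)
  qed
  let ?q = "\<lambda>y. (g y - m)\<^sup>2"
  have bq: "bounded_borel ?q"
  proof -
    obtain B where B: "g \<in> borel_measurable borel" "\<And>x. \<bar>g x\<bar> \<le> B"
      using g(1) by (rule bounded_borelE) blast
    show ?thesis
    proof (rule bounded_borelI[where B = "(B + \<bar>m\<bar>)\<^sup>2"])
      fix y
      have "\<bar>g y - m\<bar> \<le> B + \<bar>m\<bar>" using B(2)[of y] by simp
      from power_mono[OF this, of 2] show "\<bar>(g y - m)\<^sup>2\<bar> \<le> (B + \<bar>m\<bar>)\<^sup>2" by simp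
    qed (use B in measurable)
  qed
  have iq: "integrable (P x) ?q" by (rule bi[OF bq])
  have var: "(\<integral>y. ?q y \<partial>P x) \<le> a\<^sup>2 * s"
  proof -
    \<comment> \<open>Dividing by \<open>a\<close> makes \<open>g\<close> admissible in the supremum
      over 1-Lipschitz functions; its variance scales back by \<open>a\<^sup>2\<close>.\<close>
    define h where "h = (\<lambda>y. inverse a * g y)"
    have "(\<bar>inverse a\<bar> * a)-lipschitz_on UNIV h"
      unfolding h_def by (rule lipschitz_on_cmult_real[OF g(2)])
    then have "1-lipschitz_on (supp (P x)) h" using a by (auto intro: lipschitz_on_subset)
    then have "evariance (restrict_space (P x) (supp (P x))) h \<le> Lipschitz_variance_sup (P x)"
      unfolding Lipschitz_variance_sup_def by (intro SUP_upper) simp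
    then have le: "evariance (restrict_space (P x) (supp (P x))) h \<le> ennreal s"
      using s(1) by (rule order_trans)
    \<comment> \<open>The mean inside \<open>evariance\<close> is taken under the restricted
      measure; it agrees with the full mean because the support carries all the mass.\<close>
    have "(\<integral>y. h y \<partial>restrict_space (P x) (supp (P x))) = (\<integral>y. h y \<partial>P x)"
    proof (subst integral_restrict_space)
      show "(\<integral>y. indicator (supp (P x)) y *\<^sub>R h y \<partial>P x) = (\<integral>y. h y \<partial>P x)"
        unfolding h_def
      proof (rule integral_cong_AE)
        show "AE y in P x. indicator (supp (P x)) y *\<^sub>R (inverse a * g y) = inverse a * g y"
          using AE by eventually_elim simp
      qed (use clo in measurable)
    qed (use clo sp in simp)
    also have "\<dots> = inverse a * m" by (simp add: h_def m_def kernel_op_def)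
    finally have mean: "(\<integral>y. h y \<partial>restrict_space (P x) (supp (P x))) = inverse a * m" .
    have "evariance (restrict_space (P x) (supp (P x))) h
        = (\<integral>\<^sup>+ y. ennreal ((h y - inverse a * m)\<^sup>2) * indicator (supp (P x)) y \<partial>P x)"
      unfolding evariance_def mean using clo by (subst nn_integral_restrict_space) (auto simp: sp)
    also have "\<dots> = (\<integral>\<^sup>+ y. ennreal (inverse (a\<^sup>2) * ?q y) \<partial>P x)"
    proof (rule nn_integral_cong_AE, use AE in eventually_elim)
      fix y assume "y \<in> supp (P x)"
      moreover have "h y - inverse a * m = inverse a * (g y - m)" by (simp add: h_def algebra_simps)
      ultimately show "ennreal ((h y - inverse a * m)\<^sup>2) * indicator (supp (P x)) y
        = ennreal (inverse (a\<^sup>2) * ?q y)"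
        by (simp add: power_mult_distrib power_inverse)
    qed
    also have "\<dots> = ennreal (\<integral>y. inverse (a\<^sup>2) * ?q y \<partial>P x)"
      using iq by (intro nn_integral_eq_integral) auto
    finally have "ennreal (inverse (a\<^sup>2) * (\<integral>y. ?q y \<partial>P x)) \<le> ennreal s"
      using le by simp
    then have "inverse (a\<^sup>2) * (\<integral>y. ?q y \<partial>P x) \<le> s"
      using s(2) by (subst (asm) ennreal_le_iff) auto
    then show ?thesis using a by (simp add: field_simps)
  qed
  have "T (\<lambda>y. exp (g y)) x \<le> (\<integral>y. exp m * (1 + (g y - m) + ?q y) \<partial>P x)"
    unfolding kernel_op_def
  proof (rule integral_mono_AE)
    show "integrable (P x) (\<lambda>y. exp (g y))" by (rule bi[OF bounded_borel_exp[OF g(1)]])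
    show "integrable (P x) (\<lambda>y. exp m * (1 + (g y - m) + ?q y))" using ig iq by simp
    show "AE y in P x. exp (g y) \<le> exp m * (1 + (g y - m) + ?q y)"
      using AE
    proof eventually_elim
      case (elim y)
      have "exp (g y) = exp m * exp (g y - m)" by (simp flip: exp_add)
      also have "\<dots> \<le> exp m * (1 + (g y - m) + ?q y)"
        using exp_le_quadratic[OF near[OF elim]] by simp
      finally show ?case .
    qed
  qed
  also have "\<dots> = exp m * (1 + (\<integral>y. ?q y \<partial>P x))"
    using ig iq by (simp add: m_def kernel_op_def prob_space)
  also have "\<dots> \<le> exp m * (1 + a\<^sup>2 * s)" using var by simp
  also have "\<dots> \<le> exp m * exp (a\<^sup>2 * s)" by (simp add: exp_ge_add_one_self)
  finally show ?thesis by (simp add: m_def exp_add)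
qed

text \<open>Write \<open>n = q * K + r\<close>. The \<open>r\<close> leftover steps are taken first
  and cost the factor \<open>M\<close> once; afterwards each block of \<open>K\<close> steps
  contracts by \<open>u\<close>.\<close>

lemma kernel_op_pow_lipschitz_decay:
  assumes M: "\<And>k. 1 - coarse_ricci_inf P k \<le> ereal M" "0 \<le> M"
    and u: "1 - coarse_ricci_inf P K \<le> ereal u" "0 \<le> u"
    and g: "bounded_borel g" "L-lipschitz_on UNIV g"
  shows "(u ^ (n div K) * (M * L))-lipschitz_on UNIV ((T ^^ n) g)"
proof -
  have "(u ^ q * (M * L))-lipschitz_on UNIV ((T ^^ (q * K + r)) g)" for q r
  proof (induction q)
    case 0
    then show ?case using kernel_op_pow_lipschitz[OF M g] by simp
  next
    case (Suc q)
    from kernel_op_pow_lipschitz[OF u bounded_borel_kernel_op_pow[OF g(1)] Suc]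
    show ?case by (simp add: funpow_add mult.assoc add.assoc)
  qed
  from this[of "n div K" "n mod K"] show ?thesis by simp
qed

end

section \<open>Exponential moments under the stationary measure\<close>

locale stationary_kernel = markov_kernel +
  fixes \<pi> :: "'a measure"
  assumes prob: "\<pi> \<in> space (prob_algebra borel)"
    and stationary: "\<pi> \<bind> P = \<pi>"
begin

sublocale prob_space \<pi> using prob by (simp add: space_prob_algebra)

lemma sets_stationary: "sets \<pi> = sets borel"
  using prob by (simp add: space_prob_algebra)

lemma integral_kernel_op: "bounded_borel g \<Longrightarrow> (\<integral>x. T g x \<partial>\<pi>) = (\<integral>x. g x \<partial>\<pi>)"
  using integral_bind_kernel[OF _ prob] by (simp add: stationary)

lemma integral_kernel_op_pow: "bounded_borel g \<Longrightarrow> (\<integral>x. (T ^^ n) g x \<partial>\<pi>) = (\<integral>x. g x \<partial>\<pi>)"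
  by (induction n) (auto simp: integral_kernel_op bounded_borel_kernel_op_pow)

lemma exp_moment_le_bounded:
  fixes M \<kappa> \<theta> L L' :: real and f S :: "'a \<Rightarrow> real" and K :: nat
  assumes fin: "granularity P < \<infinity>"
    and M: "\<And>k. 1 - coarse_ricci_inf P k \<le> ereal M" "0 < M"
    and \<kappa>: "1 - coarse_ricci_inf P K \<le> ereal (1 - \<kappa>)" "0 < \<kappa>" "\<kappa> \<le> 1" and K: "0 < K"
    and var: "\<And>x. Lipschitz_variance_sup (P x) \<le> ennreal (S x)"
    and S: "bounded_borel S" "L'-lipschitz_on UNIV S" "\<And>x. 0 \<le> S x"
    and f: "bounded_borel f" "L-lipschitz_on UNIV f" and L: "0 < L"
    and \<theta>: "0 < \<theta>" "\<theta> * (6 * M * enn2real (granularity P) * L) \<le> 1"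
      "\<theta> * (4 * K * M\<^sup>2 * L' * L) \<le> \<kappa>"
  shows "(\<integral>x. exp (\<theta> * f x) \<partial>\<pi>)
    \<le> exp (\<theta> * (\<integral>x. f x \<partial>\<pi>) + \<theta>\<^sup>2 * (L\<^sup>2 * (\<integral>x. S x \<partial>\<pi>) * (4 * M\<^sup>2 * K / (\<kappa> - \<kappa>\<^sup>2 / 4))))"
proof -
  define u v where "u = 1 - \<kappa>" and "v = 1 - \<kappa> / 2"
  have u: "0 \<le> u" "u \<le> 1" and v: "0 < v" "v < 1" using \<kappa> by (auto simp: u_def v_def)
  \<comment> \<open>The factor 2 is the one in \<open>block_sum_bound\<close>, leaving room for the
    contributions of \<open>S\<close>; \<open>g_lip\<close> below shows that it suffices.\<close>
  define a where "a n = 2 * \<theta> * M * L * v ^ (n div K)" for n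
  have a_pos: "0 < a n" for n using M L \<theta> v by (simp add: a_def)
  have a_le: "a n \<le> 2 * \<theta> * M * L" for n
    using M L \<theta> v by (simp add: a_def mult_left_le power_le_one)
  have L': "0 \<le> L'" using lipschitz_on_nonneg[OF S(2)] .
  \<comment> \<open>Closed form of the iteration started at \<open>\<theta> * f x\<close>, whose
    recursion is \<open>g_Suc\<close>. The multiple of \<open>S\<close> added in passing from
    \<open>j\<close> to \<open>Suc j\<close> has since been averaged \<open>n - 1 - j\<close> times;
    as \<open>j < n\<close>, the subtraction is never cut off at 0.\<close>
  define g where "g n x = \<theta> * (T ^^ n) f x + (\<Sum>j<n. (a j)\<^sup>2 * (T ^^ (n - 1 - j)) S x)" for n x
  note bop = bounded_borel_kernel_op_pow[OF f(1)] bounded_borel_kernel_op_pow[OF S(1)]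
  have bsum: "bounded_borel (\<lambda>x. \<Sum>j<n. (a j)\<^sup>2 * (T ^^ (n - 1 - j)) S x)" for n
    by (intro bounded_borel_sum bounded_borel_cmult bop)
  have bg: "bounded_borel (g n)" for n
    unfolding g_def by (intro bounded_borel_add bounded_borel_cmult bop bsum)
  have g_Suc: "T (g n) x + (a n)\<^sup>2 * S x = g (Suc n) x" for n x
  proof -
    have "T (g n) x = T (\<lambda>x. \<theta> * (T ^^ n) f x) x
        + T (\<lambda>x. \<Sum>j<n. (a j)\<^sup>2 * (T ^^ (n - 1 - j)) S x) x"
      using kernel_op_add[OF bounded_borel_cmult[OF bop(1), of \<theta> n] bsum[of n]]
      by (simp add: g_def[abs_def])
    also have "T (\<lambda>x. \<theta> * (T ^^ n) f x) x = \<theta> * (T ^^ Suc n) f x"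
      by (simp add: kernel_op_cmult)
    also have "T (\<lambda>x. \<Sum>j<n. (a j)\<^sup>2 * (T ^^ (n - 1 - j)) S x) x
        = (\<Sum>j<n. T (\<lambda>x. (a j)\<^sup>2 * (T ^^ (n - 1 - j)) S x) x)"
      by (subst kernel_op_sum) (auto intro: bounded_borel_cmult bop(2))
    also have "\<dots> = (\<Sum>j<n. (a j)\<^sup>2 * (T ^^ (Suc n - 1 - j)) S x)"
    proof (rule sum.cong)
      fix j assume "j \<in> {..<n}"
      then have "Suc n - 1 - j = Suc (n - 1 - j)" by auto
      then show "T (\<lambda>x. (a j)\<^sup>2 * (T ^^ (n - 1 - j)) S x) x = (a j)\<^sup>2 * (T ^^ (Suc n - 1 - j)) S x"
        by (simp add: kernel_op_cmult)
    qed simp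
    finally have "T (g n) x = \<theta> * (T ^^ Suc n) f x + (\<Sum>j<n. (a j)\<^sup>2 * (T ^^ (Suc n - 1 - j)) S x)" .
    then show ?thesis by (simp add: g_def)
  qed
  have g_lip: "(a n)-lipschitz_on UNIV (g n)" for n
  proof -
    let ?s = "\<Sum>j<n. (v ^ (j div K))\<^sup>2 * u ^ ((n - 1 - j) div K)"
    let ?l = "\<theta> * (u ^ (n div K) * (M * L)) + (\<Sum>j<n. (a j)\<^sup>2 * (u ^ ((n - 1 - j) div K) * (M * L')))"
    have lip: "?l-lipschitz_on UNIV (g n)"
    proof (rule lipschitz_onI)
      note dec = kernel_op_pow_lipschitz_decay[OF M(1) less_imp_le[OF M(2)] \<kappa>(1)[folded u_def] u(1)]
      show "0 \<le> ?l" using \<theta> u M L L' by (intro add_nonneg_nonneg mult_nonneg_nonneg sum_nonneg) auto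
      fix x y :: 'a
      have f1: "\<bar>(T ^^ n) f x - (T ^^ n) f y\<bar> \<le> u ^ (n div K) * (M * L) * dist x y"
        using lipschitz_onD[OF dec[OF f], of x y n] by (simp add: dist_real_def)
      have S1: "\<bar>(T ^^ i) S x - (T ^^ i) S y\<bar> \<le> u ^ (i div K) * (M * L') * dist x y" for i
        using lipschitz_onD[OF dec[OF S(1,2)], of x y i] by (simp add: dist_real_def)
      have "\<bar>g n x - g n y\<bar> = \<bar>\<theta> * ((T ^^ n) f x - (T ^^ n) f y)
          + (\<Sum>j<n. (a j)\<^sup>2 * ((T ^^ (n - 1 - j)) S x - (T ^^ (n - 1 - j)) S y))\<bar>"
        by (simp add: g_def right_diff_distrib sum_subtractf)
      also have "\<dots> \<le> \<theta> * \<bar>(T ^^ n) f x - (T ^^ n) f y\<bar>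
          + (\<Sum>j<n. (a j)\<^sup>2 * \<bar>(T ^^ (n - 1 - j)) S x - (T ^^ (n - 1 - j)) S y\<bar>)"
        using \<theta> by (intro order_trans[OF abs_triangle_ineq] add_mono order_trans[OF sum_abs])
          (auto simp: abs_mult)
      also have "\<dots> \<le> \<theta> * (u ^ (n div K) * (M * L) * dist x y)
          + (\<Sum>j<n. (a j)\<^sup>2 * (u ^ ((n - 1 - j) div K) * (M * L') * dist x y))"
        using \<theta> by (intro add_mono sum_mono mult_left_mono f1 S1) auto
      also have "\<dots> = ?l * dist x y"
        by (simp add: distrib_left distrib_right sum_distrib_left sum_distrib_right mult_ac)
      finally show "dist (g n x) (g n y) \<le> ?l * dist x y" by (simp add: dist_real_def)
    qed
    have "?l = \<theta> * M * L * u ^ (n div K) + (2 * \<theta> * M * L)\<^sup>2 * (M * L') * ?s"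
      by (simp add: a_def sum_distrib_left power_mult_distrib mult_ac)
    \<comment> \<open>The product is arranged so that the last hypothesis on \<open>\<theta>\<close>
      bounds the inner factor by \<open>\<kappa>\<close>, leaving exactly the weight
      \<open>\<kappa> / K\<close> of \<open>block_sum_bound\<close>.\<close>
    also have "(2 * \<theta> * M * L)\<^sup>2 * (M * L') = \<theta> * M * L * (\<theta> * (4 * K * M\<^sup>2 * L' * L) / K)"
      using K by (simp add: power2_eq_square field_simps)
    also have "\<dots> * ?s \<le> \<theta> * M * L * (\<kappa> / K) * ?s"
      using \<theta> M L u v K by (intro mult_right_mono mult_left_mono divide_right_mono sum_nonneg) auto
    finally have "?l \<le> \<theta> * M * L * (\<kappa> / K * ?s + u ^ (n div K))" by (simp add: algebra_simps)
    also have "\<dots> \<le> \<theta> * M * L * (2 * v ^ (n div K))"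
      using block_sum_bound[OF \<kappa>(2,3) K, of n] \<theta> M L by (intro mult_left_mono) (auto simp: u_def v_def)
    also have "\<dots> = a n" by (simp add: a_def)
    finally show ?thesis by (rule lipschitz_on_le[OF lip])
  qed
  have step: "(\<integral>x. exp (g n x) \<partial>\<pi>) \<le> (\<integral>x. exp (g (Suc n) x) \<partial>\<pi>)" for n
  proof -
    have a2: "a n * (2 * enn2real (granularity P)) \<le> 1"
    proof -
      have "a n * (2 * enn2real (granularity P)) \<le> 2 * \<theta> * M * L * (2 * enn2real (granularity P))"
        using a_le by (intro mult_right_mono) auto
      \<comment> \<open>The constant 6 in the hypothesis gives 2/3, within the bound 1 that
        \<open>kernel_op_exp_le\<close> asks for.\<close>
      also have "\<dots> = 2 / 3 * (\<theta> * (6 * M * enn2real (granularity P) * L))" by simp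
      also have "\<dots> \<le> 2 / 3 * 1" by (rule mult_left_mono[OF \<theta>(2)]) simp
      finally show ?thesis by simp
    qed
    \<comment> \<open>By stationarity, averaging \<open>exp (g n x)\<close> once by the kernel does
      not change its integral.\<close>
    have "(\<integral>x. exp (g n x) \<partial>\<pi>) = (\<integral>x. T (\<lambda>y. exp (g n y)) x \<partial>\<pi>)"
      by (simp add: integral_kernel_op bounded_borel_exp bg)
    also have "\<dots> \<le> (\<integral>x. exp (g (Suc n) x) \<partial>\<pi>)"
    proof (rule integral_mono)
      show "integrable \<pi> (T (\<lambda>y. exp (g n y)))"
        using bounded_borel_kernel_op_pow[OF bounded_borel_exp[OF bg], of 1]
        by (intro bounded_borel_integrable prob) simp
      show "integrable \<pi> (\<lambda>x. exp (g (Suc n) x))"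
        by (intro bounded_borel_integrable prob bounded_borel_exp bg)
      show "T (\<lambda>y. exp (g n y)) x \<le> exp (g (Suc n) x)" for x
        using kernel_op_exp_le[OF bg g_lip fin a_pos a2 var S(3)] by (simp add: g_Suc)
    qed
    finally show ?thesis .
  qed
  define C where "C = \<theta>\<^sup>2 * (L\<^sup>2 * (4 * M\<^sup>2 * K / (\<kappa> - \<kappa>\<^sup>2 / 4)))"
  have sum_a: "(\<Sum>j<n. (a j)\<^sup>2) \<le> C" for n
  proof -
    have "(\<Sum>j<n. (a j)\<^sup>2) = (2 * \<theta> * M * L)\<^sup>2 * (\<Sum>j<n. (v ^ (j div K))\<^sup>2)"
      by (simp add: a_def sum_distrib_left power_mult_distrib)
    also have "\<dots> \<le> (2 * \<theta> * M * L)\<^sup>2 * (K / (1 - v\<^sup>2))"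
      using block_geometric_sum_le[OF v K] by (intro mult_left_mono) auto
    also have "1 - v\<^sup>2 = \<kappa> - \<kappa>\<^sup>2 / 4" by (simp add: v_def power2_eq_square field_simps)
    finally show ?thesis by (simp add: C_def power_mult_distrib mult_ac)
  qed
  obtain Bf where Bf: "\<And>x. \<bar>f x\<bar> \<le> Bf" using f(1) by (rule bounded_borelE) blast
  obtain Bs where Bs: "\<And>x. \<bar>S x\<bar> \<le> Bs" using S(1) by (rule bounded_borelE) blast
  have Bs0: "0 \<le> Bs" using Bs[of undefined] by simp
  \<comment> \<open>This bound is uniform in \<open>n\<close>, as dominated convergence below
    requires.\<close>
  define G where "G = \<theta> * Bf + C * Bs"
  have g_bound: "\<bar>g n x\<bar> \<le> G" for n x
  proof -
    have "\<bar>g n x\<bar> \<le> \<theta> * \<bar>(T ^^ n) f x\<bar> + (\<Sum>j<n. (a j)\<^sup>2 * \<bar>(T ^^ (n - 1 - j)) S x\<bar>)"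
      unfolding g_def using \<theta>
      by (intro order_trans[OF abs_triangle_ineq] add_mono order_trans[OF sum_abs])
        (auto simp: abs_mult)
    also have "\<dots> \<le> \<theta> * Bf + (\<Sum>j<n. (a j)\<^sup>2 * Bs)"
      using \<theta> kernel_op_pow_bounded(2)[OF f(1) Bf] kernel_op_pow_bounded(2)[OF S(1) Bs]
      by (intro add_mono sum_mono mult_left_mono) auto
    also have "\<dots> \<le> G"
      unfolding G_def sum_distrib_right[symmetric]
      using sum_a Bs0 by (intro add_left_mono mult_right_mono)
    finally show ?thesis .
  qed
  define E where "E = \<theta> * (\<integral>x. f x \<partial>\<pi>) + C * (\<integral>x. S x \<partial>\<pi>)"
  have mean: "(\<integral>x. g n x \<partial>\<pi>) \<le> E" for n
  proof -
    have "(\<integral>x. g n x \<partial>\<pi>) = \<theta> * (\<integral>x. f x \<partial>\<pi>) + (\<Sum>j<n. (a j)\<^sup>2) * (\<integral>x. S x \<partial>\<pi>)"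
    proof -
      note int = bounded_borel_integrable[OF _ prob]
      have "(\<integral>x. g n x \<partial>\<pi>) = (\<integral>x. \<theta> * (T ^^ n) f x \<partial>\<pi>)
          + (\<integral>x. (\<Sum>j<n. (a j)\<^sup>2 * (T ^^ (n - 1 - j)) S x) \<partial>\<pi>)"
        unfolding g_def
        by (rule Bochner_Integration.integral_add[OF int[OF bounded_borel_cmult[OF bop(1)]] int[OF bsum]])
      also have "(\<integral>x. (\<Sum>j<n. (a j)\<^sup>2 * (T ^^ (n - 1 - j)) S x) \<partial>\<pi>)
          = (\<Sum>j<n. \<integral>x. (a j)\<^sup>2 * (T ^^ (n - 1 - j)) S x \<partial>\<pi>)"
        by (rule Bochner_Integration.integral_sum[OF int[OF bounded_borel_cmult[OF bop(2)]]])
      finally show ?thesis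
        by (simp add: integral_kernel_op_pow f S sum_distrib_right)
    qed
    then show ?thesis
      unfolding E_def using sum_a S(3) by (simp add: mult_right_mono integral_nonneg)
  qed
  \<comment> \<open>The iterates flatten out, but convergence of their level is not yet known. So
    they are compared with their value at an arbitrary point: \<open>d n\<close> tends to 0
    pointwise because the Lipschitz constants \<open>a n\<close> do.\<close>
  define x0 :: 'a where "x0 = undefined"
  have a_lim: "a \<longlonglongrightarrow> 0"
  proof -
    have "filterlim (\<lambda>n. n div K) at_top sequentially"
      unfolding filterlim_at_top
    proof
      fix Z
      show "\<forall>\<^sub>F n in sequentially. Z \<le> n div K"
        using eventually_ge_at_top[of "Z * K"] by eventually_elim (simp add: K less_eq_div_iff_mult_less_eq)
    qed
    from filterlim_compose[OF LIMSEQ_power_zero this, of v]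
    have "(\<lambda>n. v ^ (n div K)) \<longlonglongrightarrow> 0" using v by simp
    from tendsto_mult_left[OF this, of "2 * \<theta> * M * L"] show ?thesis by (simp add: a_def[abs_def])
  qed
  define d where "d n x = g n x - g n x0" for n x
  have d_lim: "(\<lambda>n. d n x) \<longlonglongrightarrow> 0" for x
  proof (rule Lim_null_comparison)
    show "\<forall>\<^sub>F n in sequentially. norm (d n x) \<le> a n * dist x x0"
      using lipschitz_onD[OF g_lip, of x x0] by (auto simp: d_def dist_real_def)
    show "(\<lambda>n. a n * dist x x0) \<longlonglongrightarrow> 0"
      using tendsto_mult_right[OF a_lim, of "dist x x0"] by simp
  qed
  have d_bound: "\<bar>d n x\<bar> \<le> 2 * G" for n x
    using g_bound[of n x] g_bound[of n x0] by (simp add: d_def)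
  have bd: "bounded_borel (d n)" for n
    unfolding d_def using bounded_borel_add[OF bg bounded_borel_const[of "- g n x0"]] by simp
  have md: "d n \<in> borel_measurable \<pi>" for n
    using bd[of n] by (simp add: bounded_borel_def measurable_cong_sets[OF sets_stationary refl])
  have l1: "(\<lambda>n. \<integral>x. d n x \<partial>\<pi>) \<longlonglongrightarrow> (\<integral>x. 0 \<partial>\<pi>)"
    by (rule integral_dominated_convergence[where w = "\<lambda>_. 2 * G"])
      (use d_lim d_bound md in auto)
  have l2: "(\<lambda>n. \<integral>x. exp (d n x) \<partial>\<pi>) \<longlonglongrightarrow> (\<integral>x. 1 \<partial>\<pi>)"
  proof (rule integral_dominated_convergence[where w = "\<lambda>_. exp (2 * G)"])
    show "AE x in \<pi>. (\<lambda>n. exp (d n x)) \<longlonglongrightarrow> 1"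
      using tendsto_exp[OF d_lim] by simp
    show "AE x in \<pi>. norm (exp (d n x)) \<le> exp (2 * G)" for n
      using d_bound[of n] by (auto simp: abs_le_iff)
  qed (use md in auto)
  \<comment> \<open>The level \<open>g n x0\<close> is the mean of \<open>g n\<close> minus the mean
    of \<open>d n\<close>, hence at most \<open>E\<close> minus the latter. So every term of this
    sequence dominates the initial moment, and its limit is \<open>exp E\<close>.\<close>
  have "(\<lambda>n. exp (E - (\<integral>x. d n x \<partial>\<pi>)) * (\<integral>x. exp (d n x) \<partial>\<pi>)) \<longlonglongrightarrow> exp (E - (\<integral>x. 0 \<partial>\<pi>)) * (\<integral>x. 1 \<partial>\<pi>)"
    by (intro tendsto_intros l1 l2)
  then have lim: "(\<lambda>n. exp (E - (\<integral>x. d n x \<partial>\<pi>)) * (\<integral>x. exp (d n x) \<partial>\<pi>)) \<longlonglongrightarrow> exp E"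
    by (simp add: prob_space)
  have "(\<integral>x. exp (g 0 x) \<partial>\<pi>) \<le> exp (E - (\<integral>x. d n x \<partial>\<pi>)) * (\<integral>x. exp (d n x) \<partial>\<pi>)" for n
  proof -
    have "(\<integral>x. exp (g 0 x) \<partial>\<pi>) \<le> (\<integral>x. exp (g n x) \<partial>\<pi>)"
      by (induction n) (use step order_trans in auto)
    also have "\<dots> = exp (g n x0) * (\<integral>x. exp (d n x) \<partial>\<pi>)"
      by (simp add: d_def flip: exp_add integral_mult_right_zero)
    also have "g n x0 = (\<integral>x. g n x \<partial>\<pi>) - (\<integral>x. d n x \<partial>\<pi>)"
      using bounded_borel_integrable[OF bg prob] by (simp add: d_def prob_space)
    also have "exp \<dots> * (\<integral>x. exp (d n x) \<partial>\<pi>) \<le> exp (E - (\<integral>x. d n x \<partial>\<pi>)) * (\<integral>x. exp (d n x) \<partial>\<pi>)"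
      using mean by (intro mult_right_mono) (auto intro: integral_nonneg)
    finally show ?thesis .
  qed
  then have "(\<integral>x. exp (g 0 x) \<partial>\<pi>) \<le> exp E"
    by (intro LIMSEQ_le_const[OF lim]) auto
  then show ?thesis by (simp add: g_def E_def C_def mult_ac)
qed

end

subsection \<open>Removing the boundedness assumption\<close>

definition clip :: "real \<Rightarrow> real \<Rightarrow> real" where
  "clip r y = max (- r) (min r y)"

lemma abs_clip: "0 \<le> r \<Longrightarrow> \<bar>clip r y\<bar> = min r \<bar>y\<bar>"
  by (auto simp: clip_def)

lemma abs_clip_diff_le: "\<bar>clip r x - clip r y\<bar> \<le> \<bar>x - y\<bar>"
  by (auto simp: clip_def max_def min_def)

lemma clip_tendsto: "(\<lambda>n. clip (real n) y) \<longlonglongrightarrow> y"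
proof (rule tendsto_eventually)
  show "\<forall>\<^sub>F n in sequentially. clip (real n) y = y"
    using eventually_ge_at_top[of "nat \<lceil>\<bar>y\<bar>\<rceil>"]
  proof eventually_elim
    case (elim n)
    then have "\<bar>y\<bar> \<le> real n" by linarith
    then show ?case by (auto simp: clip_def)
  qed
qed

lemma borel_measurable_clip [measurable]: "clip r \<in> borel_measurable borel"
  unfolding clip_def by measurable

context prob_space
begin

text \<open>Multiplying the two hypotheses cancels the unknown means of the truncations and leaves
  \<open>exp (2 * c)\<close>. Both moments share a positive lower bound independent of
  \<open>n\<close>, so each is bounded uniformly in \<open>n\<close>, and monotone convergence
  removes the truncation.\<close>

lemma exp_abs_integrable_of_clipped:
  fixes f :: "'a \<Rightarrow> real"
  assumes [measurable]: "f \<in> borel_measurable M" and \<theta>: "0 < \<theta>"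
    and pos: "\<And>n::nat. expectation (\<lambda>x. exp (\<theta> * clip n (f x)))
      \<le> exp (\<theta> * expectation (\<lambda>x. clip n (f x)) + c)"
    and neg: "\<And>n::nat. expectation (\<lambda>x. exp (- \<theta> * clip n (f x)))
      \<le> exp (- \<theta> * expectation (\<lambda>x. clip n (f x)) + c)"
  shows "integrable M (\<lambda>x. exp (\<theta> * \<bar>f x\<bar>))"
proof -
  define A where "A m = {x \<in> space M. \<bar>f x\<bar> \<le> real m}" for m :: nat
  have A [measurable]: "A m \<in> events" for m unfolding A_def by measurable
  \<comment> \<open>The sets \<open>A m\<close> cover the space and cannot all be null. On the
    chosen one the clipped values are at most \<open>m\<close> in absolute value for every
    \<open>n\<close>, which yields the lower bound \<open>q\<close>.\<close>
  obtain m where "emeasure M (A m) \<noteq> 0"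
  proof (rule ccontr)
    assume "\<not> thesis"
    with that have "\<And>m. emeasure M (A m) = 0" by auto
    then have "emeasure M (\<Union>m. A m) = 0" by (intro emeasure_UN_eq_0) auto
    moreover have "(\<Union>m. A m) = space M" by (auto simp: A_def real_arch_simple)
    ultimately show False using emeasure_space_1 by simp
  qed
  then have p: "0 < prob (A m)" by (simp add: emeasure_eq_measure measure_le_0_iff less_le)
  have iA: "integrable M (indicator (A m) :: 'a \<Rightarrow> real)"
    by (rule integrable_const_bound[where B = 1]) auto
  define q where "q = exp (- \<theta> * m) * prob (A m)"
  have q: "0 < q" using p by (simp add: q_def)
  have ie: "integrable M (\<lambda>x. exp (s * clip (real n) (f x)))" if s: "\<bar>s\<bar> = \<theta>" for s n
  proof (rule integrable_const_bound[where B = "exp (\<theta> * n)"])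
    have "s * clip (real n) y \<le> \<theta> * n" for y
    proof -
      have "s * clip (real n) y \<le> \<bar>s\<bar> * \<bar>clip (real n) y\<bar>" by (metis abs_ge_self abs_mult)
      also have "\<dots> \<le> \<theta> * n" using s \<theta> by (simp add: abs_clip)
      finally show ?thesis .
    qed
    then show "AE x in M. norm (exp (s * clip (real n) (f x))) \<le> exp (\<theta> * n)" by simp
  qed measurable
  have low: "q \<le> expectation (\<lambda>x. exp (s * clip (real n) (f x)))" if s: "\<bar>s\<bar> = \<theta>" for s n
  proof -
    have "q = expectation (\<lambda>x. exp (- \<theta> * m) * indicator (A m) x)"
      by (simp add: q_def)
    also have "\<dots> \<le> expectation (\<lambda>x. exp (s * clip (real n) (f x)))"
    proof (rule integral_mono)
      fix x assume "x \<in> space M"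
      show "exp (- \<theta> * m) * indicator (A m) x \<le> exp (s * clip (real n) (f x))"
      proof (cases "x \<in> A m")
        case True
        have "- (s * clip (real n) (f x)) \<le> \<bar>s\<bar> * \<bar>clip (real n) (f x)\<bar>"
          by (metis abs_ge_minus_self abs_mult)
        also have "\<dots> \<le> \<theta> * m" using s \<theta> True by (auto simp: abs_clip A_def min_le_iff_disj)
        finally show ?thesis using True by simp
      qed simp
    qed (use ie[OF s] iA in auto)
    finally show ?thesis .
  qed
  define Q where "Q = exp (2 * c) / q"
  have Q: "expectation (\<lambda>x. exp (\<theta> * \<bar>clip (real n) (f x)\<bar>)) \<le> 2 * Q" for n
  proof -
    let ?e = "expectation (\<lambda>x. clip (real n) (f x))"
    let ?a = "expectation (\<lambda>x. exp (\<theta> * clip (real n) (f x)))"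
    let ?b = "expectation (\<lambda>x. exp (- \<theta> * clip (real n) (f x)))"
    have i: "integrable M (\<lambda>x. exp (\<theta> * clip (real n) (f x)))"
      "integrable M (\<lambda>x. exp (- \<theta> * clip (real n) (f x)))"
      using ie[of \<theta> n] ie[of "- \<theta>" n] \<theta> by auto
    have l: "q \<le> ?a" "q \<le> ?b" using low[of \<theta> n] low[of "- \<theta>" n] \<theta> by auto
    \<comment> \<open>Replacing one moment by its lower bound \<open>q\<close> isolates the
      other.\<close>
    have "?a * q \<le> exp (\<theta> * ?e + c) * exp (- \<theta> * ?e + c)"
      using l(2) neg[of n] by (intro mult_mono pos) (auto intro: less_imp_le[OF q])
    moreover have "q * ?b \<le> exp (\<theta> * ?e + c) * exp (- \<theta> * ?e + c)"
      using l(1) pos[of n] q l(2) by (intro mult_mono neg) auto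
    moreover have "exp (\<theta> * ?e + c) * exp (- \<theta> * ?e + c) = exp (2 * c)"
      by (simp flip: exp_add)
    ultimately have "?a \<le> Q" "?b \<le> Q" using q by (auto simp: Q_def field_simps)
    have "expectation (\<lambda>x. exp (\<theta> * \<bar>clip (real n) (f x)\<bar>))
        \<le> expectation (\<lambda>x. exp (\<theta> * clip (real n) (f x)) + exp (- \<theta> * clip (real n) (f x)))"
      using i by (intro integral_mono') (auto simp: abs_if)
    also have "\<dots> = ?a + ?b" using i by (rule Bochner_Integration.integral_add)
    finally show ?thesis using \<open>?a \<le> Q\<close> \<open>?b \<le> Q\<close> by simp
  qed
  \<comment> \<open>Monotone convergence applies to the absolute value, which is
    \<open>min n \<bar>f x\<bar>\<close>; the clipped function itself decreases in \<open>n\<close>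
    where \<open>f\<close> is negative.\<close>
  have "(\<lambda>n. \<integral>\<^sup>+x. ennreal (exp (\<theta> * \<bar>clip (real n) (f x)\<bar>)) \<partial>M)
    \<longlonglongrightarrow> (\<integral>\<^sup>+x. ennreal (exp (\<theta> * \<bar>f x\<bar>)) \<partial>M)"
  proof (rule nn_integral_LIMSEQ)
    show "incseq (\<lambda>n x. ennreal (exp (\<theta> * \<bar>clip (real n) (f x)\<bar>)))"
      using \<theta> by (intro incseq_SucI le_funI ennreal_leI) (simp add: abs_clip)
    show "(\<lambda>n. ennreal (exp (\<theta> * \<bar>clip (real n) (f x)\<bar>))) \<longlonglongrightarrow> ennreal (exp (\<theta> * \<bar>f x\<bar>))" for x
      by (intro tendsto_intros clip_tendsto)
  qed measurable
  moreover have "(\<integral>\<^sup>+x. ennreal (exp (\<theta> * \<bar>clip (real n) (f x)\<bar>)) \<partial>M) \<le> ennreal (2 * Q)" for n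
  proof -
    have "integrable M (\<lambda>x. exp (\<theta> * \<bar>clip (real n) (f x)\<bar>))"
    proof (rule integrable_const_bound[where B = "exp (\<theta> * n)"])
      show "AE x in M. norm (exp (\<theta> * \<bar>clip (real n) (f x)\<bar>)) \<le> exp (\<theta> * n)"
        using \<theta> by (simp add: abs_clip)
    qed measurable
    then show ?thesis using Q[of n] by (subst nn_integral_eq_integral) (auto intro: ennreal_leI)
  qed
  ultimately have "(\<integral>\<^sup>+x. ennreal (exp (\<theta> * \<bar>f x\<bar>)) \<partial>M) \<le> ennreal (2 * Q)"
    by (intro LIMSEQ_le_const2) auto
  also have "\<dots> < \<infinity>" by simp
  finally show ?thesis by (intro integrableI_bounded) auto
qed

text \<open>Exponential integrability of \<open>\<bar>f x\<bar>\<close> supplies a dominating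
  function, so the means and both moments of the truncations converge to those of \<open>f\<close>,
  and the moment bounds pass to the limit.\<close>

lemma two_sided_Chernoff_of_clipped:
  fixes f :: "'a \<Rightarrow> real"
  assumes [measurable]: "f \<in> borel_measurable M" and \<theta>: "0 < \<theta>"
    and pos: "\<And>n::nat. expectation (\<lambda>x. exp (\<theta> * clip n (f x)))
      \<le> exp (\<theta> * expectation (\<lambda>x. clip n (f x)) + c)"
    and neg: "\<And>n::nat. expectation (\<lambda>x. exp (- \<theta> * clip n (f x)))
      \<le> exp (- \<theta> * expectation (\<lambda>x. clip n (f x)) + c)"
  shows "prob {x \<in> space M. t \<le> \<bar>f x - expectation f\<bar>} \<le> 2 * exp (c - \<theta> * t)"
proof -
  have ia: "integrable M (\<lambda>x. exp (\<theta> * \<bar>f x\<bar>))"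
    by (rule exp_abs_integrable_of_clipped[OF assms])
  have abs_le: "\<theta> * \<bar>y\<bar> \<le> exp (\<theta> * \<bar>y\<bar>)" for y
    using exp_ge_add_one_self[of "\<theta> * \<bar>y\<bar>"] by linarith
  have "integrable M (\<lambda>x. \<theta> * f x)"
    by (rule Bochner_Integration.integrable_bound[OF ia]) (use abs_le \<theta> in \<open>auto simp: abs_mult\<close>)
  then have int_f: "integrable M f" using \<theta> by simp
  have mean: "(\<lambda>n. expectation (\<lambda>x. clip (real n) (f x))) \<longlonglongrightarrow> expectation f"
    by (rule integral_dominated_convergence[where w = "\<lambda>x. \<bar>f x\<bar>"])
      (use int_f in \<open>auto simp: abs_clip clip_tendsto\<close>)
  define e where "e = expectation f"
  have moment: "integrable M (\<lambda>x. exp (s * (f x - e))) \<and> expectation (\<lambda>x. exp (s * (f x - e))) \<le> exp c"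
    if s: "\<bar>s\<bar> = \<theta>" for s
  proof -
    have le: "s * y \<le> \<theta> * \<bar>y\<bar>" for y
      using abs_ge_self[of "s * y"] s by (simp add: abs_mult)
    have i: "integrable M (\<lambda>x. exp (s * f x))"
      by (rule Bochner_Integration.integrable_bound[OF ia]) (use le in auto)
    have "s = \<theta> \<or> s = - \<theta>" using s by linarith
    then have bound: "expectation (\<lambda>x. exp (s * clip (real n) (f x)))
        \<le> exp (s * expectation (\<lambda>x. clip (real n) (f x)) + c)" for n
      using pos[of n] neg[of n] by auto
    have "(\<lambda>n. expectation (\<lambda>x. exp (s * clip (real n) (f x)))) \<longlonglongrightarrow> expectation (\<lambda>x. exp (s * f x))"
    proof (rule integral_dominated_convergence[OF _ _ ia])
      show "AE x in M. (\<lambda>n. exp (s * clip (real n) (f x))) \<longlonglongrightarrow> exp (s * f x)"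
        by (intro AE_I2 tendsto_intros clip_tendsto)
      show "AE x in M. norm (exp (s * clip (real n) (f x))) \<le> exp (\<theta> * \<bar>f x\<bar>)" for n
      proof (rule AE_I2)
        fix x
        have "\<theta> * \<bar>clip (real n) (f x)\<bar> \<le> \<theta> * \<bar>f x\<bar>" using \<theta> by (simp add: abs_clip)
        then show "norm (exp (s * clip (real n) (f x))) \<le> exp (\<theta> * \<bar>f x\<bar>)"
          using le[of "clip (real n) (f x)"] by simp
      qed
    qed measurable
    moreover have "(\<lambda>n. exp (s * expectation (\<lambda>x. clip (real n) (f x)) + c)) \<longlonglongrightarrow> exp (s * e + c)"
      unfolding e_def by (intro tendsto_intros mean)
    ultimately have "expectation (\<lambda>x. exp (s * f x)) \<le> exp (s * e + c)"
      by (rule LIMSEQ_le) (use bound in auto)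
    moreover have eq: "exp (s * (f x - e)) = exp (- (s * e)) * exp (s * f x)" for x
      by (simp add: right_diff_distrib flip: exp_add)
    ultimately have "expectation (\<lambda>x. exp (s * (f x - e))) \<le> exp (- (s * e)) * exp (s * e + c)"
      by (simp add: eq)
    moreover have "integrable M (\<lambda>x. exp (s * (f x - e)))" unfolding eq using i by simp
    moreover have "exp (- (s * e)) * exp (s * e + c) = exp c" by (simp flip: exp_add)
    ultimately show ?thesis by simp
  qed
  have m1: "integrable M (\<lambda>x. exp (\<theta> * (f x - e)))" "expectation (\<lambda>x. exp (\<theta> * (f x - e))) \<le> exp c"
    using moment[of \<theta>] \<theta> by auto
  have m2: "integrable M (\<lambda>x. exp (- \<theta> * (f x - e)))" "expectation (\<lambda>x. exp (- \<theta> * (f x - e))) \<le> exp c"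
    using moment[of "- \<theta>"] \<theta> by auto
  define A where "A = {x \<in> space M. t \<le> \<bar>f x - e\<bar>}"
  have [measurable]: "A \<in> events" unfolding A_def by measurable
  have iA: "integrable M (indicator A :: 'a \<Rightarrow> real)"
    by (rule integrable_const_bound[where B = 1]) auto
  \<comment> \<open>Markov's inequality for both tails at once: on \<open>A\<close> the threshold
    \<open>exp (\<theta> * t)\<close> is at most the sum of the two exponentials.\<close>
  have "prob A * exp (\<theta> * t) = expectation (\<lambda>x. exp (\<theta> * t) * indicator A x)"
    by simp
  also have "\<dots> \<le> expectation (\<lambda>x. exp (\<theta> * (f x - e)) + exp (- \<theta> * (f x - e)))"
  proof (rule integral_mono)
    fix x assume "x \<in> space M"
    show "exp (\<theta> * t) * indicator A x \<le> exp (\<theta> * (f x - e)) + exp (- \<theta> * (f x - e))"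
    proof (cases "x \<in> A")
      case True
      then have "\<theta> * t \<le> \<theta> * \<bar>f x - e\<bar>" using \<theta> by (simp add: A_def)
      then have "exp (\<theta> * t) \<le> exp (\<theta> * \<bar>f x - e\<bar>)" by simp
      also have "\<dots> \<le> exp (\<theta> * (f x - e)) + exp (- \<theta> * (f x - e))"
        by (cases "0 \<le> f x - e") (auto simp: algebra_simps)
      finally show ?thesis using True by simp
    qed simp
  qed (use m1 m2 iA in auto)
  also have "\<dots> \<le> 2 * exp c" using m1 m2 by simp
  finally have "prob A \<le> 2 * exp c / exp (\<theta> * t)" by (simp add: field_simps)
  then show ?thesis by (simp add: A_def e_def exp_diff)
qed

end

context stationary_kernel
begin

text \<open>The parameter \<open>\<theta>\<close> stays free here, subject to smallness, and is
  chosen in the theorem. Capping \<open>S\<close> preserves its Lipschitz constant, its sign and the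
  variance bound, and can only lower its expectation.\<close>

lemma tail_le:
  fixes M \<kappa> \<theta> L L' t :: real and f S :: "'a \<Rightarrow> real" and K :: nat
  assumes fin: "granularity P < \<infinity>"
    and M: "\<And>k. 1 - coarse_ricci_inf P k \<le> ereal M" "0 < M"
    and \<kappa>: "1 - coarse_ricci_inf P K \<le> ereal (1 - \<kappa>)" "0 < \<kappa>" "\<kappa> \<le> 1" and K: "0 < K"
    and var: "\<And>x. Lipschitz_variance_sup (P x) \<le> ennreal (S x)" "\<And>x. 0 \<le> S x"
    and S: "L'-lipschitz_on UNIV S" "integrable \<pi> S"
    and f: "L-lipschitz_on UNIV f" and L: "0 < L"
    and \<theta>: "0 < \<theta>" "\<theta> * (6 * M * enn2real (granularity P) * L) \<le> 1"
      "\<theta> * (4 * K * M\<^sup>2 * L' * L) \<le> \<kappa>"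
  shows "prob {x. t \<le> \<bar>f x - expectation f\<bar>}
    \<le> 2 * exp (\<theta>\<^sup>2 * (L\<^sup>2 * expectation S * (4 * M\<^sup>2 * K / (\<kappa> - \<kappa>\<^sup>2 / 4))) - \<theta> * t)"
proof -
  define R where "R = (2 * enn2real (granularity P))\<^sup>2"
  define S' where "S' x = min (S x) R" for x
  have R: "0 \<le> R" by (simp add: R_def)
  have S'_lip: "L'-lipschitz_on UNIV S'"
  proof (rule lipschitz_onI)
    fix x y :: 'a
    have "\<bar>S x - S y\<bar> \<le> L' * dist x y"
      using lipschitz_onD[OF S(1), of x y] by (simp add: dist_real_def)
    then show "dist (S' x) (S' y) \<le> L' * dist x y"
      by (auto simp: S'_def dist_real_def min_def)
  qed (rule lipschitz_on_nonneg[OF S(1)])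
  have S'_bound: "0 \<le> S' x" "\<bar>S' x\<bar> \<le> R" for x using var(2)[of x] R by (auto simp: S'_def)
  have S'_bb: "bounded_borel S'" by (rule lipschitz_bounded_borel[OF S'_lip S'_bound(2)])
  have var': "Lipschitz_variance_sup (P x) \<le> ennreal (S' x)" for x
    using var(1)[of x] diffusion_over_dimension(2)[OF kernel_prob[of x] fin]
    by (auto simp: S'_def R_def min_def)
  define E where "E = L\<^sup>2 * expectation S * (4 * M\<^sup>2 * K / (\<kappa> - \<kappa>\<^sup>2 / 4))"
  have \<kappa>2: "0 \<le> \<kappa> - \<kappa>\<^sup>2 / 4"
    using mult_left_mono[of \<kappa> 1 \<kappa>] \<kappa> by (simp add: power2_eq_square)
  have moment: "expectation (\<lambda>x. exp (\<theta> * h x)) \<le> exp (\<theta> * expectation h + \<theta>\<^sup>2 * E)"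
    if h: "bounded_borel h" "L-lipschitz_on UNIV h" for h
  proof -
    have "expectation (\<lambda>x. exp (\<theta> * h x)) \<le> exp (\<theta> * expectation h
        + \<theta>\<^sup>2 * (L\<^sup>2 * expectation S' * (4 * M\<^sup>2 * K / (\<kappa> - \<kappa>\<^sup>2 / 4))))"
      by (rule exp_moment_le_bounded[OF fin M \<kappa> K var' S'_bb S'_lip S'_bound(1) h L \<theta>])
    moreover have "expectation S' \<le> expectation S"
      by (rule integral_mono[OF bounded_borel_integrable[OF S'_bb prob] S(2)]) (simp add: S'_def)
    then have "\<theta>\<^sup>2 * (L\<^sup>2 * expectation S' * (4 * M\<^sup>2 * K / (\<kappa> - \<kappa>\<^sup>2 / 4))) \<le> \<theta>\<^sup>2 * E"
      unfolding E_def using \<kappa>2 by (intro mult_left_mono mult_right_mono) auto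
    ultimately show ?thesis by (meson add_left_mono exp_le_cancel_iff order_trans)
  qed
  have f_meas: "f \<in> borel_measurable \<pi>"
    using borel_measurable_continuous_onI[OF lipschitz_on_continuous_on[OF f]]
    by (simp add: measurable_cong_sets[OF sets_stationary refl])
  have clip: "bounded_borel (\<lambda>x. clip (real n) (f x))" "L-lipschitz_on UNIV (\<lambda>x. clip (real n) (f x))" for n
  proof -
    show lip: "L-lipschitz_on UNIV (\<lambda>x. clip (real n) (f x))"
    proof (rule lipschitz_onI)
      fix x y :: 'a
      show "dist (clip (real n) (f x)) (clip (real n) (f y)) \<le> L * dist x y"
        using abs_clip_diff_le[of "real n" "f x" "f y"] lipschitz_onD[OF f, of x y]
        by (simp add: dist_real_def)
    qed (use L in simp)
    show "bounded_borel (\<lambda>x. clip (real n) (f x))"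
      by (rule lipschitz_bounded_borel[OF lip, of "real n"]) (simp add: abs_clip)
  qed
  have "prob {x \<in> space \<pi>. t \<le> \<bar>f x - expectation f\<bar>} \<le> 2 * exp (\<theta>\<^sup>2 * E - \<theta> * t)"
  proof (rule two_sided_Chernoff_of_clipped[OF f_meas \<theta>(1)])
    fix n :: nat
    show "expectation (\<lambda>x. exp (\<theta> * clip n (f x)))
        \<le> exp (\<theta> * expectation (\<lambda>x. clip n (f x)) + \<theta>\<^sup>2 * E)"
      by (rule moment[OF clip])
    \<comment> \<open>The smallness conditions do not see the sign of the function, so the moment
      bound also applies to the negated truncation.\<close>
    show "expectation (\<lambda>x. exp (- \<theta> * clip n (f x)))
        \<le> exp (- \<theta> * expectation (\<lambda>x. clip n (f x)) + \<theta>\<^sup>2 * E)"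
      using moment[of "\<lambda>x. - clip n (f x)"] clip[of n] bounded_borel_cmult[OF clip(1), of "- 1" n]
      by simp
  qed
  then show ?thesis
    using sets_eq_imp_space_eq[OF sets_stationary] by (simp add: E_def)
qed

end

section \<open>Choice of the Chernoff parameter\<close>

theorem theorem3p17:
  fixes P :: "'a::polish_space \<Rightarrow> 'a measure"
    and \<pi> :: "'a measure"
    and f S :: "'a \<Rightarrow> real"
    and K :: nat
    and M \<sigma>inf \<kappa> D lam_max t_max :: real
  assumes kernel: "P \<in> borel \<rightarrow>\<^sub>M prob_algebra borel"
    and prob: "\<pi> \<in> space (prob_algebra borel)"
    and stationary: "\<pi> \<bind> P = \<pi>"
    and W1_finite: "\<And>x. W1 (return borel x) (P x) < \<infinity>"
    and granularity: "0 < granularity P" "granularity P < \<infinity>"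
    and M_finite: "max_expansion P < \<infinity>"
    and f_Lipschitz: "\<exists>L. L-lipschitz_on UNIV f"
    and f_nontrivial: "0 < Lip_coeff f"
    and S_Lipschitz: "\<exists>L. L-lipschitz_on UNIV S"
    and S_bound:
      "\<And>x. enn2ereal ((coarse_diffusion P x)\<^sup>2 / local_dimension P x) \<le> ereal (S x)"
    and S_expectation: "integrable \<pi> S" "0 < (\<integral>x. S x \<partial>\<pi>)"
    and K: "0 < K" "0 < coarse_ricci_inf P K"
    and M_def: "M = real_of_ereal (max_expansion P)"
    and sigma_def: "\<sigma>inf = enn2real (granularity P)"
    and kappa_def: "\<kappa> = real_of_ereal (coarse_ricci_inf P K)"
    and D_def: "D = (Lip_coeff f)\<^sup>2 * (\<integral>x. S x \<partial>\<pi>) * (16 * M\<^sup>2 * real K / (\<kappa> - \<kappa>\<^sup>2 / 4))"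
    and lam_max_def: "lam_max =
      (if Lip_coeff S = 0 then 1 / (6 * M * \<sigma>inf * Lip_coeff f)
       else min (1 / (6 * M * \<sigma>inf * Lip_coeff f))
                (\<kappa> / (4 * real K * M\<^sup>2 * Lip_coeff S * Lip_coeff f)))"
    and t_max_def: "t_max = D * lam_max / 2"
  shows "(\<forall>t. 0 \<le> t \<and> t \<le> t_max \<longrightarrow>
            measure \<pi> {x. \<bar>f x - (\<integral>z. f z \<partial>\<pi>)\<bar> \<ge> t} \<le> 2 * exp (- (t\<^sup>2 / D))) \<and>
         (\<forall>t > t_max.
            measure \<pi> {x. \<bar>f x - (\<integral>z. f z \<partial>\<pi>)\<bar> \<ge> t}
              \<le> 2 * exp (- (t_max\<^sup>2 / D) - (t - t_max) * lam_max))"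
proof -
  let ?L = "Lip_coeff f" and ?L' = "Lip_coeff S"
  interpret stationary_kernel P \<pi>
    by unfold_locales (fact kernel prob stationary)+
  have L: "?L-lipschitz_on UNIV f" by (rule Lip_coeff_lipschitz[OF f_Lipschitz])
  have L': "?L'-lipschitz_on UNIV S" by (rule Lip_coeff_lipschitz[OF S_Lipschitz])
  have L'0: "0 \<le> ?L'" by (rule lipschitz_on_nonneg[OF L'])
  have ricci_le_1: "coarse_ricci_inf P k \<le> 1" for k
  proof -
    \<comment> \<open>The curvature is 1 on the diagonal by definition, so this holds even on a
      one-point space.\<close>
    have "coarse_ricci_inf P k \<le> coarse_ricci P k undefined undefined"
      unfolding coarse_ricci_inf_def by (meson INF_lower UNIV_I order_trans)
    then show ?thesis by (simp add: coarse_ricci_def)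
  qed
  \<comment> \<open>Being positive and at most 1, the infimum is finite, and
    \<open>real_of_ereal\<close> loses nothing.\<close>
  have \<kappa>_eq: "coarse_ricci_inf P K = ereal \<kappa>"
    using ricci_le_1[of K] K(2) by (cases "coarse_ricci_inf P K") (auto simp: kappa_def one_ereal_def)
  have \<kappa>: "0 < \<kappa>" "\<kappa> \<le> 1" "1 - coarse_ricci_inf P K \<le> ereal (1 - \<kappa>)"
    using K(2) ricci_le_1[of K] by (auto simp: \<kappa>_eq one_ereal_def)
  have \<kappa>2: "0 < \<kappa> - \<kappa>\<^sup>2 / 4"
    using mult_left_mono[of \<kappa> 1 \<kappa>] \<kappa> by (simp add: power2_eq_square)
  have sup: "1 - coarse_ricci_inf P k \<le> max_expansion P" for k
    unfolding max_expansion_def by (rule SUP_upper) simp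
  have "0 \<le> 1 - coarse_ricci_inf P K" using \<kappa> by (simp add: \<kappa>_eq one_ereal_def)
  then have me0: "0 \<le> max_expansion P" using sup[of K] by (rule order_trans)
  then have M_eq: "max_expansion P = ereal M" and M0: "0 \<le> M"
    using M_finite by (cases "max_expansion P"; auto simp: M_def)+
  have M: "1 - coarse_ricci_inf P k \<le> ereal M" for k using sup by (simp add: M_eq)
  have \<sigma>: "0 < \<sigma>inf" using granularity by (simp add: sigma_def enn2real_positive_iff)
  have var: "Lipschitz_variance_sup (P x) \<le> ennreal (S x)" "0 \<le> S x" for x
  proof -
    let ?V = "Lipschitz_variance_sup (P x)"
    \<comment> \<open>Nonnegativity of the variance supremum forces \<open>S x\<close> to be
      nonnegative, so that \<open>ennreal (S x)\<close> is faithful to \<open>S x\<close>.\<close>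
    have le: "enn2ereal ?V \<le> ereal (S x)"
      using S_bound[of x] diffusion_over_dimension(1)[OF kernel_prob[of x] granularity(2)] by simp
    have "0 \<le> enn2ereal ?V" by simp
    then have "0 \<le> ereal (S x)" using le by (rule order_trans)
    then show "0 \<le> S x" by simp
    then show "?V \<le> ennreal (S x)"
      using le by (simp add: less_eq_ennreal.rep_eq enn2ereal_ennreal)
  qed
  have prob_le_2: "prob A \<le> 2" for A using prob_le_1[of A] by linarith
  let ?p = "\<lambda>t. prob {x. t \<le> \<bar>f x - expectation f\<bar>}"
  show ?thesis
  proof (cases "M = 0")
    \<comment> \<open>Excluded in fact by \<open>0 < granularity P\<close>, but then \<open>1 / 0 = 0\<close> turns every bound into \<open>2\<close>.\<close>
    case True
    then show ?thesis using prob_le_2 L'0 \<kappa> by (simp add: D_def lam_max_def t_max_def)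
  next
    case False
    then have M_pos: "0 < M" using M0 by simp
    have D: "0 < D"
      unfolding D_def using f_nontrivial S_expectation M_pos K \<kappa>2 by simp
    define c1 where "c1 = 6 * M * \<sigma>inf * ?L"
    define c2 where "c2 = 4 * real K * M\<^sup>2 * ?L' * ?L"
    have c1: "0 < c1" using M_pos \<sigma> f_nontrivial by (simp add: c1_def)
    have c2: "0 \<le> c2" using L'0 f_nontrivial by (simp add: c2_def)
    have c2_pos: "0 < c2" if "?L' \<noteq> 0"
      using that L'0 f_nontrivial K(1) M_pos by (simp add: c2_def)
    have lam: "lam_max = (if ?L' = 0 then 1 / c1 else min (1 / c1) (\<kappa> / c2))"
      by (simp add: lam_max_def c1_def c2_def)
    have lam_pos: "0 < lam_max" using c1 c2_pos \<kappa> by (auto simp: lam)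
    have lam1: "lam_max * c1 \<le> 1"
      using c1 by (auto simp: lam field_simps min_def)
    \<comment> \<open>When the second term of the minimum is absent, \<open>c2 = 0\<close> and the
      constraint is void.\<close>
    have lam2: "lam_max * c2 \<le> \<kappa>"
    proof (cases "?L' = 0")
      case True
      then show ?thesis using \<kappa> by (simp add: c2_def)
    next
      case False
      then have "lam_max \<le> \<kappa> / c2" by (simp add: lam)
      then show ?thesis using c2_pos[OF False] by (simp add: field_simps)
    qed
    \<comment> \<open>\<open>D\<close> carries the constant 16 where \<open>tail_le\<close> has 4,
      hence \<open>D / 4\<close>.\<close>
    have tail: "?p t \<le> 2 * exp (\<theta>\<^sup>2 * (D / 4) - \<theta> * t)" if \<theta>: "0 < \<theta>" "\<theta> \<le> lam_max" for \<theta> t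
    proof -
      have "\<theta> * c1 \<le> 1" by (rule order_trans[OF mult_right_mono[OF \<theta>(2) less_imp_le[OF c1]] lam1])
      moreover have "\<theta> * c2 \<le> \<kappa>" by (rule order_trans[OF mult_right_mono[OF \<theta>(2) c2] lam2])
      ultimately have "?p t \<le> 2 * exp (\<theta>\<^sup>2 * (?L\<^sup>2 * expectation S
          * (4 * M\<^sup>2 * K / (\<kappa> - \<kappa>\<^sup>2 / 4))) - \<theta> * t)"
        by (intro tail_le[OF granularity(2) M M_pos \<kappa>(3,1,2) K(1) var L' S_expectation(1) L f_nontrivial \<theta>(1)])
          (simp_all add: c1_def c2_def sigma_def)
      also have "?L\<^sup>2 * expectation S * (4 * M\<^sup>2 * K / (\<kappa> - \<kappa>\<^sup>2 / 4)) = D / 4"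
      proof -
        have "x * (4 * M\<^sup>2 * K / q) = x * (16 * M\<^sup>2 * K / q) / 4" for x q by simp
        then show ?thesis by (simp only: D_def)
      qed
      finally show ?thesis .
    qed
    show ?thesis
    proof (intro conjI allI impI)
      fix t assume t: "0 \<le> t \<and> t \<le> t_max"
      show "?p t \<le> 2 * exp (- (t\<^sup>2 / D))"
      \<comment> \<open>At \<open>t = 0\<close> the optimal parameter would be 0, which
        \<open>tail\<close> excludes; the bound is then the trivial one, 2.\<close>
      proof (cases "t = 0")
        case True
        then show ?thesis using prob_le_2 by simp
      next
        case False
        \<comment> \<open>This minimises \<open>\<theta>\<^sup>2 * (D / 4) - \<theta> * t\<close>,
          with minimum \<open>- (t\<^sup>2 / D)\<close>; it is at most \<open>lam_max\<close>
          exactly when \<open>t \<le> t_max\<close>.\<close>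
        define \<theta> where "\<theta> = 2 * t / D"
        have "0 < \<theta>" "\<theta> \<le> lam_max"
          using False t D by (auto simp: \<theta>_def t_max_def field_simps)
        from tail[OF this, of t] show ?thesis
          using D by (simp add: \<theta>_def power2_eq_square field_simps)
      qed
    next
      fix t assume "t_max < t"
      \<comment> \<open>Beyond \<open>t_max\<close> the minimiser exceeds \<open>lam_max\<close>, so
        the endpoint \<open>\<theta> = lam_max\<close> is used and the exponent becomes affine in
        \<open>t\<close>.\<close>
      have "lam_max\<^sup>2 * (D / 4) - lam_max * t = - (t_max\<^sup>2 / D) - (t - t_max) * lam_max"
        using D by (simp add: t_max_def power2_eq_square field_simps)
      then show "?p t \<le> 2 * exp (- (t_max\<^sup>2 / D) - (t - t_max) * lam_max)"
        using tail[OF lam_pos order_refl, of t] by simp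
    qed
  qed
qed

end
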